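(* Define the five sets of patterns $$\Pi_1=\{1234,1243,1342\},\quad \Pi_2=\{1243,1324,1342\},\quad \Pi_3=\{1324,1342,1432\},$$ $$\Pi_4=\{2314,3214,4213\},\quad \Pi_5=\{3214,3241,4213\}.$$ Then, for every $j\in\{1,2,3,4,5\}$, $$\sum_{n\geq 0}\#S_n(\Pi_j)\,x^n=\frac{1-5x+(1+x)\sqrt{1-4x}}{1-5x+(1-x)\sqrt{1-4x}}$$ as formal power series in $x$.
   Context: $S_n$ is the set of permutations $\pi=\pi_1\pi_2\cdots\pi_n$ of $\{1,\dots,n\}$ in one-line notation ($S_0$ consists of the empty permutation). For $\tau\in S_k$, $\pi\in S_n$ contains $\tau$ if there are indices $1\le i_1<\cdots<i_k\le n$ such that $\pi_{i_1}\cdots\pi_{i_k}$ is order-isomorphic to $\tau$; otherwise $\pi$ avoids $\tau$. For a finite set $T$ of patterns, $S_n(T)$ is the set of $\pi\in S_n$ that avoid every $\tau\in T$. $\sqrt{1-4x}$ denotes the formal power series square root of $1-4x$ with constant term $1$. *)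

theory Defs
  imports
    Complex_Main
    "HOL-Combinatorics.Multiset_Permutations"
    "HOL-Computational_Algebra.Formal_Power_Series"
begin

definition order_isomorphic :: "nat list \<Rightarrow> nat list \<Rightarrow> bool" where
  "order_isomorphic xs ys \<longleftrightarrow> length xs = length ys \<and>
     (\<forall>a < length xs. \<forall>b < length xs. xs ! a < xs ! b \<longleftrightarrow> ys ! a < ys ! b)"

(* is = [i_1, ..., i_k] lists the (0-based) positions i_1 < ... < i_k of an occurrence of \<tau>;
   its length k is forced by order_isomorphic. *)
definition contains :: "nat list \<Rightarrow> nat list \<Rightarrow> bool" where
  "contains \<pi> \<tau> \<longleftrightarrow>
     (\<exists>is. sorted_wrt (<) is \<and> set is \<subseteq> {..<length \<pi>} \<and>
           order_isomorphic (map ((!) \<pi>) is) \<tau>)"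

definition avoids :: "nat list \<Rightarrow> nat list \<Rightarrow> bool" where
  "avoids \<pi> \<tau> \<longleftrightarrow> \<not> contains \<pi> \<tau>"

definition avoiders :: "nat \<Rightarrow> nat list set \<Rightarrow> nat list set" where
  "avoiders n T = {\<pi> \<in> permutations_of_set {1..n}. \<forall>\<tau>\<in>T. avoids \<pi> \<tau>}"

definition avoiders_gf :: "nat list set \<Rightarrow> real fps" where
  "avoiders_gf T = Abs_fps (\<lambda>n. of_nat (card (avoiders n T)))"

definition Pi1 :: "nat list set" where "Pi1 = {[1,2,3,4], [1,2,4,3], [1,3,4,2]}"
definition Pi2 :: "nat list set" where "Pi2 = {[1,2,4,3], [1,3,2,4], [1,3,4,2]}"
definition Pi3 :: "nat list set" where "Pi3 = {[1,3,2,4], [1,3,4,2], [1,4,3,2]}"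
definition Pi4 :: "nat list set" where "Pi4 = {[2,3,1,4], [3,2,1,4], [4,2,1,3]}"
definition Pi5 :: "nat list set" where "Pi5 = {[3,2,1,4], [3,2,4,1], [4,2,1,3]}"

definition sqrt_1_minus_4X :: "real fps" where
  "sqrt_1_minus_4X = fps_radical root 2 (1 - 4 * fps_X)"

lemma sqrt_1_minus_4X_unique:
  "s = sqrt_1_minus_4X \<longleftrightarrow> s\<^sup>2 = 1 - 4 * fps_X \<and> fps_nth s 0 = 1"
proof -
  let ?b = "1 - 4 * fps_X :: real fps"
  have b0: "fps_nth ?b 0 = 1" by simp
  have "s\<^sup>2 = ?b \<longleftrightarrow> s = sqrt_1_minus_4X" if "fps_nth s 0 = 1"
    using radical_unique[of root 1 ?b s] that b0
    by (simp add: sqrt_1_minus_4X_def numeral_2_eq_2)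
  moreover have "fps_nth sqrt_1_minus_4X 0 = 1"
    by (simp add: sqrt_1_minus_4X_def)
  ultimately show ?thesis by blast
qed

end

theory Submission
  imports Defs "HOL-Library.Sublist"
begin

text \<open>
  A permutation of size \<open>n + 1\<close> arises from one of size \<open>n\<close> by prepending a value \<open>v\<close> and raising the
  entries \<open>\<ge> v\<close>. For each of the five classes (for \<open>\<Pi>\<^sub>4\<close> and \<open>\<Pi>\<^sub>5\<close> after reversing the patterns) the
  admissible values \<open>v\<close> form an interval, and a few statistics of the permutation determine this
  interval and the statistics of all children. If formal power series are attached to
  permutations so that the series at \<open>w\<close> is \<open>1 + x\<close> times the sum of the series at the children
  of \<open>w\<close>, then the series at \<open>w\<close> counts the descendants of \<open>w\<close>, and the one at the empty permutation is
  the generating function. Solving the resulting recurrences by the kernel method gives explicit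
  series in the Catalan series \<open>C = 1 + x C\<^sup>2\<close>, and in all five cases the value at the root is
  \<open>1 + (C - 1) (2 - C) / (1 + C - C\<^sup>2)\<close>.
\<close>

section \<open>The generating tree of a class\<close>

text \<open>The series are verified rather than derived, because consistency along the tree already
  determines them (\<open>avoiders_gf_eqI\<close>). Their shape has this origin. Differencing the
  recurrence for \<open>diag\<close>, and likewise the one for \<open>gf_sigma\<close>, leads to the
  characteristic polynomial x t^2 - t + 1 with roots C and 1/(x C). Only C is a power series, so
  solutions are built on powers of C, and excluding the other root is what fixes the unknown
  boundary value. The obstacle is to find statistics that the children inherit. For the first three
  classes two integers suffice. For the reversed \<open>Pi4\<close> and \<open>Pi5\<close> it
  matters which admissible values are right-to-left maxima: in the first case this enters as a
  product over values, in the second it always forms at most three blocks. Reciprocals are named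
  series with a polynomial relation, and powers of C are replaced by free variables, so every
  identity becomes an ideal membership that \<open>algebra\<close> can decide.\<close>

lemma subseq_map_iff: "subseq s (map f w) \<longleftrightarrow> (\<exists>t. subseq t w \<and> s = map f t)"
  by (auto simp: subseq_conv_nths nths_map)

lemma contains_iff_subseq:
  "contains w \<tau> \<longleftrightarrow> (\<exists>s. subseq s w \<and> order_isomorphic s \<tau>)"
proof -
  have "(\<exists>is. sorted_wrt (<) is \<and> set is \<subseteq> {..<length w} \<and> s = map ((!) w) is) \<longleftrightarrow> subseq s w" for s
  proof -
    have "sorted_wrt (<) is \<and> set is \<subseteq> {..<length w} \<longleftrightarrow> subseq is [0..<length w]" for "is"
    proof
      assume "sorted_wrt (<) is \<and> set is \<subseteq> {..<length w}"
      then show "subseq is [0..<length w]"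
        by (intro sorted_subset_imp_subseq) (auto simp: strict_sorted_iff)
    next
      assume *: "subseq is [0..<length w]"
      then obtain N where N: "is = nths [0..<length w] N"
        by (auto simp: subseq_conv_nths)
      then show "sorted_wrt (<) is \<and> set is \<subseteq> {..<length w}"
        by (auto simp: strict_sorted_iff sorted_nths dest: in_set_nthsD)
    qed
    then show ?thesis
      using subseq_map_iff[of s "(!) w" "[0..<length w]"] by (auto simp: map_nth)
  qed
  then show ?thesis
    unfolding contains_def by metis
qed

text \<open>On a word with distinct entries this is a strict linear order of the entries. An
  occurrence of length four then reduces to three comparisons of neighbours
  (\<open>subseq4_iff_before\<close>), and positions disappear.\<close>

definition before :: "nat list \<Rightarrow> nat \<Rightarrow> nat \<Rightarrow> bool" where
  "before w a b \<longleftrightarrow> subseq [a, b] w"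

lemma before_Nil [simp]: "\<not> before [] a b"
  by (simp add: before_def)

lemma before_Cons:
  "before (x # w) a b \<longleftrightarrow> (if a = x then b \<in> set w else before w a b)"
  by (simp add: before_def subseq_singleton_left)

lemma before_in_set: "before w a b \<Longrightarrow> a \<in> set w \<and> b \<in> set w"
  by (induction w) (auto simp: before_Cons split: if_splits)

lemma before_neq: "distinct w \<Longrightarrow> before w a b \<Longrightarrow> a \<noteq> b"
  by (induction w) (auto simp: before_Cons split: if_splits)

lemma before_asym: "distinct w \<Longrightarrow> before w a b \<Longrightarrow> \<not> before w b a"
  by (induction w) (auto simp: before_Cons split: if_splits dest: before_in_set)

lemma before_trans: "distinct w \<Longrightarrow> before w a b \<Longrightarrow> before w b c \<Longrightarrow> before w a c"
  by (induction w) (auto simp: before_Cons split: if_splits dest: before_in_set)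

lemma before_total:
  "a \<in> set w \<Longrightarrow> b \<in> set w \<Longrightarrow> a \<noteq> b \<Longrightarrow> before w a b \<or> before w b a"
  by (induction w) (auto simp: before_Cons)

lemma subseq_Cons_Cons_iff_before:
  "distinct w \<Longrightarrow> subseq (a # b # s) w \<longleftrightarrow> before w a b \<and> subseq (b # s) w"
proof (induction w)
  case (Cons x w)
  have "subseq (b # s) w \<Longrightarrow> b \<in> set w"
    by (induction w) (auto split: if_splits)
  then show ?case
    using Cons by (auto simp: before_Cons dest: before_in_set)
qed simp

lemma subseq4_iff_before:
  "distinct w \<Longrightarrow> subseq [a, b, c, d] w \<longleftrightarrow> before w a b \<and> before w b c \<and> before w c d"
  by (auto simp: subseq_Cons_Cons_iff_before subseq_singleton_left dest: before_in_set)

section \<open>Inserting a new first entry\<close>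

definition bump :: "nat \<Rightarrow> nat \<Rightarrow> nat" where
  "bump v y = (if y < v then y else Suc y)"

definition prepend :: "nat \<Rightarrow> nat list \<Rightarrow> nat list" where
  "prepend v w = v # map (bump v) w"

lemma bump_less_iff [simp]: "bump v a < bump v b \<longleftrightarrow> a < b"
  by (auto simp: bump_def)

lemma bump_eq_iff [simp]: "bump v a = bump v b \<longleftrightarrow> a = b"
  by (auto simp: bump_def)

lemma bump_neq [simp]: "bump v a \<noteq> v" "v \<noteq> bump v a"
  by (auto simp: bump_def)

lemma bump_less_self_iff [simp]: "bump v a < v \<longleftrightarrow> a < v" "v < bump v a \<longleftrightarrow> v \<le> a"
  by (auto simp: bump_def)

lemma length_prepend [simp]: "length (prepend v w) = Suc (length w)"
  by (simp add: prepend_def)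

lemma before_map_bump:
  "before (map (bump v) w) x y \<longleftrightarrow> (\<exists>a b. x = bump v a \<and> y = bump v b \<and> before w a b)"
  unfolding before_def subseq_map_iff
  by (auto simp: Cons_eq_map_conv) 

lemma before_prepend:
  "before (prepend v w) x y \<longleftrightarrow>
     x = v \<and> y \<in> bump v ` set w \<or> (\<exists>a b. x = bump v a \<and> y = bump v b \<and> before w a b)"
  by (auto simp: prepend_def before_Cons before_map_bump)

abbreviation perms :: "nat \<Rightarrow> nat list set" where
  "perms n \<equiv> permutations_of_set {1..n}"

lemma permsD:
  assumes "w \<in> perms n"
  shows "distinct w" "set w = {1..n}" "length w = n"
  using permutations_of_setD[OF assms] length_finite_permutations_of_set[OF assms] by simp_all

lemma bump_image: "v \<in> {1..Suc n} \<Longrightarrow> bump v ` {1..n} = {1..Suc n} - {v}"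
proof (intro equalityI subsetI)
  fix x assume v: "v \<in> {1..Suc n}" and "x \<in> {1..Suc n} - {v}"
  then have "x = bump v (if x < v then x else x - 1) \<and> (if x < v then x else x - 1) \<in> {1..n}"
    by (auto simp: bump_def)
  then show "x \<in> bump v ` {1..n}"
    by blast
qed (auto simp: bump_def)

lemma prepend_in_perms: "w \<in> perms n \<Longrightarrow> v \<in> {1..Suc n} \<Longrightarrow> prepend v w \<in> perms (Suc n)"
  using bump_image[of v n]
  by (auto simp: permutations_of_set_def prepend_def distinct_map inj_on_def)

lemma perms_Suc: "perms (Suc n) = (\<lambda>(v, w). prepend v w) ` ({1..Suc n} \<times> perms n)"
proof (intro equalityI subsetI)
  fix x assume x: "x \<in> perms (Suc n)"
  obtain v u where vu: "x = v # u"
    using permsD(3)[OF x] by (cases x) simp_all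
  have "insert v (set u) = {1..Suc n}" and u1: "distinct u" "v \<notin> set u"
    using permsD(1,2)[OF x] unfolding vu by simp_all
  then have v: "v \<in> {1..Suc n}" and u: "distinct u" "set u = {1..Suc n} - {v}"
    by blast+
  \<comment> \<open>Closing the gap at \<open>v\<close> inverts \<open>bump v\<close>, since
    \<open>v\<close> itself does not occur in \<open>u\<close>.\<close>
  define w where "w = map (\<lambda>y. if y < v then y else y - 1) u"
  have "bump v (if y < v then y else y - 1) = y" if "y \<in> set u" for y
  proof -
    have "y \<noteq> v"
      using that u1(2) by blast
    then show ?thesis
      by (cases "y < v") (simp_all add: bump_def)
  qed
  then have "map (bump v) w = u"
    unfolding w_def map_map comp_def by (rule map_idI)
  then have w: "u = map (bump v) w" ..
  have inj: "inj (bump v)"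
    by (simp add: inj_def)
  have "bump v ` set w = bump v ` {1..n}"
    using bump_image[OF v] u(2) w by simp
  then have "set w = {1..n}"
    by (simp only: inj_image_eq_iff[OF inj])
  then have "w \<in> perms n" "x = prepend v w"
    using u(1) vu w by (simp_all add: permutations_of_set_def prepend_def distinct_map)
  then show "x \<in> (\<lambda>(v, w). prepend v w) ` ({1..Suc n} \<times> perms n)"
    using v by (intro image_eqI[of _ _ "(v, w)"]) simp_all
next
  fix x assume "x \<in> (\<lambda>(v, w). prepend v w) ` ({1..Suc n} \<times> perms n)"
  then obtain v w where "x = prepend v w" "v \<in> {1..Suc n}" "w \<in> perms n"
    by fast
  then show "x \<in> perms (Suc n)"
    using prepend_in_perms by simp
qed

definition pat :: "nat list set \<Rightarrow> nat \<Rightarrow> nat \<Rightarrow> nat \<Rightarrow> nat \<Rightarrow> bool" where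
  "pat T a b c d \<longleftrightarrow> (\<exists>\<tau>\<in>T. order_isomorphic [a, b, c, d] \<tau>)"

definition sites :: "nat list set \<Rightarrow> nat list \<Rightarrow> nat set" where
  "sites T w = {v \<in> {1..Suc (length w)}.
     \<not> (\<exists>b c d. before w b c \<and> before w c d \<and> pat T v (bump v b) (bump v c) (bump v d))}"

lemma finite_sites [simp]: "finite (sites T w)"
  by (simp add: sites_def)

lemma order_isomorphic_4:
  "order_isomorphic [a, b, c, d] [p, q, r, s] \<longleftrightarrow>
    (a < b \<longleftrightarrow> p < q) \<and> (a < c \<longleftrightarrow> p < r) \<and> (a < d \<longleftrightarrow> p < s) \<and> (b < c \<longleftrightarrow> q < r) \<and>
    (b < d \<longleftrightarrow> q < s) \<and> (c < d \<longleftrightarrow> r < s) \<and>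
    (b < a \<longleftrightarrow> q < p) \<and> (c < a \<longleftrightarrow> r < p) \<and> (d < a \<longleftrightarrow> s < p) \<and> (c < b \<longleftrightarrow> r < q) \<and>
    (d < b \<longleftrightarrow> s < q) \<and> (d < c \<longleftrightarrow> s < r)"
proof -
  have All4: "(\<forall>i<Suc (Suc (Suc (Suc 0))). P i) \<longleftrightarrow>
      P 0 \<and> P (Suc 0) \<and> P (Suc (Suc 0)) \<and> P (Suc (Suc (Suc 0)))" for P
    by (auto simp: less_Suc_eq)
  show ?thesis
    by (simp add: order_isomorphic_def All4 conj_ac)
qed

lemma order_isomorphic_map_bump:
  "order_isomorphic (map (bump v) s) \<tau> \<longleftrightarrow> order_isomorphic s \<tau>"
  by (simp add: order_isomorphic_def)

lemma avoids_all_iff: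
  assumes "\<forall>\<tau>\<in>T. length \<tau> = 4" "distinct w"
  shows "(\<forall>\<tau>\<in>T. avoids w \<tau>) \<longleftrightarrow>
    \<not> (\<exists>a b c d. before w a b \<and> before w b c \<and> before w c d \<and> pat T a b c d)"
proof -
  have "(\<exists>s. subseq s w \<and> order_isomorphic s \<tau>) \<longleftrightarrow>
      (\<exists>a b c d. subseq [a, b, c, d] w \<and> order_isomorphic [a, b, c, d] \<tau>)" if "\<tau> \<in> T" for \<tau>
  proof -
    have "\<exists>a b c d. s = [a, b, c, d]" if "order_isomorphic s \<tau>" for s
    proof -
      have "length s = Suc (Suc (Suc (Suc 0)))"
        using that assms(1) \<open>\<tau> \<in> T\<close> by (simp add: order_isomorphic_def)
      then show ?thesis by (auto simp: length_Suc_conv)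
    qed
    then show ?thesis by metis
  qed
  then have "(\<forall>\<tau>\<in>T. avoids w \<tau>) \<longleftrightarrow>
      (\<forall>\<tau>\<in>T. \<not> (\<exists>a b c d. subseq [a, b, c, d] w \<and> order_isomorphic [a, b, c, d] \<tau>))"
    by (intro ball_cong refl) (simp only: avoids_def contains_iff_subseq)
  then show ?thesis
    unfolding pat_def subseq4_iff_before[OF assms(2)] by auto
qed

text \<open>An occurrence in \<open>prepend v w\<close> that misses the first entry is an occurrence
  in \<open>w\<close>, as \<open>bump v\<close> preserves order. Only occurrences starting at
  \<open>v\<close> are new, and these are what \<open>sites\<close> tests.\<close>

lemma avoiders_Suc:
  assumes T: "\<forall>\<tau>\<in>T. length \<tau> = 4"
  shows "avoiders (Suc n) T = (\<lambda>(w, v). prepend v w) ` (SIGMA w:avoiders n T. sites T w)"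
proof -
  have *: "(\<forall>\<tau>\<in>T. avoids (prepend v w) \<tau>) \<longleftrightarrow> (\<forall>\<tau>\<in>T. avoids w \<tau>) \<and> v \<in> sites T w"
    if w: "w \<in> perms n" and v: "v \<in> {1..Suc n}" for v w
  proof -
    have d: "distinct w" "distinct (prepend v w)"
      using permsD[OF w] permsD[OF prepend_in_perms[OF w v]] by auto
    have inv: "pat T (bump v a) (bump v b) (bump v c) (bump v e) \<longleftrightarrow> pat T a b c e" for a b c e
      using order_isomorphic_map_bump[of v "[a, b, c, e]"] by (simp add: pat_def)
    have "(\<exists>a b c e. before (prepend v w) a b \<and> before (prepend v w) b c \<and>
            before (prepend v w) c e \<and> pat T a b c e) \<longleftrightarrow>
          (\<exists>a b c e. before w a b \<and> before w b c \<and> before w c e \<and> pat T a b c e) \<or>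
          (\<exists>b c e. before w b c \<and> before w c e \<and> pat T v (bump v b) (bump v c) (bump v e))"
      (is "?L \<longleftrightarrow> ?R")
    proof
      assume ?L
      then show ?R
        by (auto simp: before_prepend inv)
    next
      assume ?R
      then show ?L
      proof (elim disjE exE conjE)
        fix a b c e assume "before w a b" "before w b c" "before w c e" "pat T a b c e"
        then show ?L
          by (intro exI[of _ "bump v a"] exI[of _ "bump v b"] exI[of _ "bump v c"] exI[of _ "bump v e"])
            (auto simp: before_prepend inv)
      next
        fix b c e assume "before w b c" "before w c e" "pat T v (bump v b) (bump v c) (bump v e)"
        then show ?L
          by (intro exI[of _ v] exI[of _ "bump v b"] exI[of _ "bump v c"] exI[of _ "bump v e"])
            (auto simp: before_prepend inv dest: before_in_set)
      qed
    qed
    then show ?thesis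
      using v permsD(3)[OF w] by (simp add: avoids_all_iff[OF T] d sites_def)
  qed
  have len: "sites T w \<subseteq> {1..Suc n}" if "w \<in> perms n" for w
    using permsD(3)[OF that] by (auto simp: sites_def)
  show ?thesis
  proof (intro equalityI subsetI)
    fix x assume x: "x \<in> avoiders (Suc n) T"
    then have "x \<in> perms (Suc n)"
      by (simp add: avoiders_def)
    then obtain v w where vw: "x = prepend v w" "v \<in> {1..Suc n}" "w \<in> perms n"
      unfolding perms_Suc by fast
    then have "w \<in> avoiders n T" "v \<in> sites T w"
      using x *[OF vw(3,2)] unfolding avoiders_def by blast+
    then show "x \<in> (\<lambda>(w, v). prepend v w) ` (SIGMA w:avoiders n T. sites T w)"
      using vw(1) by (intro image_eqI[of _ _ "(w, v)"]) auto
  next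
    fix x assume "x \<in> (\<lambda>(w, v). prepend v w) ` (SIGMA w:avoiders n T. sites T w)"
    then obtain v w where vw: "x = prepend v w" "v \<in> sites T w" "w \<in> avoiders n T"
      by auto
    then have wv: "w \<in> perms n" "v \<in> {1..Suc n}"
      using len unfolding avoiders_def by blast+
    then show "x \<in> avoiders (Suc n) T"
      using vw *[OF wv] prepend_in_perms unfolding avoiders_def by blast
  qed
qed

primrec descendants :: "nat list set \<Rightarrow> nat \<Rightarrow> nat list \<Rightarrow> nat" where
  "descendants T 0 w = 1"
| "descendants T (Suc m) w = (\<Sum>v\<in>sites T w. descendants T m (prepend v w))"

lemma finite_avoiders [simp]: "finite (avoiders n T)"
  by (simp add: avoiders_def)

text \<open>\<open>prepend\<close> is injective in both arguments, so a generation is the disjoint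
  union of the children of the previous one. \<open>n\<close> must vary because the induction step
  moves to the next generation.\<close>

lemma card_avoiders_add:
  assumes T: "\<forall>\<tau>\<in>T. length \<tau> = 4"
  shows "card (avoiders (n + m) T) = (\<Sum>w\<in>avoiders n T. descendants T m w)"
proof (induction m arbitrary: n)
  case (Suc m)
  have "card (avoiders (n + Suc m) T) = (\<Sum>w\<in>avoiders (Suc n) T. descendants T m w)"
    using Suc[of "Suc n"] by simp
  also have "\<dots> = (\<Sum>(w, v)\<in>(SIGMA w:avoiders n T. sites T w). descendants T m (prepend v w))"
    unfolding avoiders_Suc[OF T]
    by (subst sum.reindex) (auto simp: inj_on_def prepend_def case_prod_beta intro: map_injective simp: inj_def)
  also have "\<dots> = (\<Sum>w\<in>avoiders n T. descendants T (Suc m) w)"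
    by (simp add: sum.Sigma)
  finally show ?case .
qed simp

lemma avoiders_0:
  assumes T: "\<forall>\<tau>\<in>T. length \<tau> = 4"
  shows "avoiders 0 T = {[]}"
  using avoids_all_iff[OF T, of "[]"] by (auto simp: avoiders_def)

text \<open>\<open>R w G\<close> is a guess that \<open>G\<close> counts the descendants of
  \<open>w\<close>. Because of the factor x, coefficient m + 1 of a guess depends only on
  coefficient m of the guesses at the children, so guesses that are consistent along the tree are
  correct.\<close>

lemma avoiders_gf_eqI:
  assumes T: "\<forall>\<tau>\<in>T. length \<tau> = 4"
    and root: "R [] G"
    and step: "\<And>n w G. w \<in> perms n \<Longrightarrow> R w G \<Longrightarrow>
      \<exists>H. G = 1 + fps_X * (\<Sum>v\<in>sites T w. H v) \<and> (\<forall>v\<in>sites T w. R (prepend v w) (H v))"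
  shows "avoiders_gf T = G"
proof -
  have "real (descendants T m w) = fps_nth G m" if "w \<in> perms n" "R w G" for m n w G
    using that
  proof (induction m arbitrary: n w G)
    case 0
    from step[OF 0] obtain H where "G = 1 + fps_X * (\<Sum>v\<in>sites T w. H v)" by blast
    then show ?case by simp
  next
    case (Suc m)
    from step[OF Suc.prems] obtain H where G: "G = 1 + fps_X * (\<Sum>v\<in>sites T w. H v)"
      and H: "\<And>v. v \<in> sites T w \<Longrightarrow> R (prepend v w) (H v)" by blast
    have "prepend v w \<in> perms (Suc n)" if "v \<in> sites T w" for v
      using that prepend_in_perms[OF Suc.prems(1)] permsD(3)[OF Suc.prems(1)] by (auto simp: sites_def)
    then have "real (descendants T m (prepend v w)) = fps_nth (H v) m" if "v \<in> sites T w" for v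
      using Suc.IH H that by blast
    then show ?case
      by (simp add: G fps_sum_nth)
  qed
  from this[of "[]" 0 G] root have "real (descendants T m []) = fps_nth G m" for m
    by simp
  then show ?thesis
    using card_avoiders_add[OF T, of 0] by (simp add: avoiders_gf_def avoiders_0[OF T] fps_eq_iff)
qed

section \<open>Reversal symmetry\<close>

lemma order_isomorphic_rev:
  "order_isomorphic (rev s) (rev \<tau>) \<longleftrightarrow> order_isomorphic s \<tau>"
proof -
  have *: "order_isomorphic s \<tau> \<Longrightarrow> order_isomorphic (rev s) (rev \<tau>)" for s \<tau>
    by (auto simp: order_isomorphic_def rev_nth)
  show ?thesis
    using *[of s \<tau>] *[of "rev s" "rev \<tau>"] by auto
qed

lemma subseq_rev_iff: "subseq (rev s) (rev w) \<longleftrightarrow> subseq s w"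
proof -
  have *: "subseq s w \<Longrightarrow> subseq (rev s) (rev w)" for s w :: "'b list"
    by (induction rule: list_emb.induct) (auto intro: subseq_rev_drop_many)
  show ?thesis
    using *[of s w] *[of "rev s" "rev w"] by auto
qed

lemma avoids_rev: "avoids (rev w) (rev \<tau>) \<longleftrightarrow> avoids w \<tau>"
proof -
  have "(\<exists>s. subseq s (rev w) \<and> order_isomorphic s (rev \<tau>)) \<longleftrightarrow>
        (\<exists>s. subseq (rev s) (rev w) \<and> order_isomorphic (rev s) (rev \<tau>))"
    by (metis rev_rev_ident)
  then show ?thesis
    by (simp add: avoids_def contains_iff_subseq order_isomorphic_rev subseq_rev_iff)
qed

lemma avoiders_gf_rev: "avoiders_gf (rev ` T) = avoiders_gf T"
proof -
  have "avoiders n (rev ` T) = rev ` avoiders n T" for n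
  proof -
    have "avoiders n (rev ` T) = {w \<in> rev ` perms n. \<forall>\<tau>\<in>rev ` T. avoids w \<tau>}"
      unfolding avoiders_def by simp
    also have "\<dots> = rev ` avoiders n T"
      by (auto simp: avoiders_def avoids_rev simp del: rev_permutations_of_set)
    finally show ?thesis .
  qed
  then show ?thesis
    by (simp add: avoiders_gf_def card_image)
qed

section \<open>The Catalan series\<close>

text \<open>The closed form (1 - sqrt(1 - 4x)) / (2x). The shift divides by x, exactly because the
  numerator has constant term 0.\<close>

definition Cat :: "real fps" where
  "Cat = fps_const (1 / 2) * fps_shift 1 (1 - sqrt_1_minus_4X)"

lemma sqrt_eq_Cat: "sqrt_1_minus_4X = 1 - 2 * fps_X * Cat"
proof -
  let ?s = "sqrt_1_minus_4X"
  have s0: "fps_nth ?s 0 = 1"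
    using sqrt_1_minus_4X_unique by blast
  have "fps_X * fps_shift 1 (1 - ?s) = 1 - ?s"
    using s0 by (auto simp: fps_eq_iff)
  moreover have "2 * fps_X * Cat = fps_X * fps_shift 1 (1 - ?s)"
    by (simp add: Cat_def fps_eq_iff numeral_fps_const mult.assoc)
  ultimately show ?thesis
    by simp
qed

lemma Cat_eq: "Cat = 1 + fps_X * Cat\<^sup>2"
proof -
  have "(1 - 2 * fps_X * Cat)\<^sup>2 = 1 - 4 * fps_X"
    using sqrt_1_minus_4X_unique unfolding sqrt_eq_Cat[symmetric] by blast
  then have "4 * fps_X * (1 + fps_X * Cat\<^sup>2 - Cat) = 0"
    by algebra
  then show ?thesis
    by simp
qed

lemma Cat_0 [simp]: "fps_nth Cat 0 = 1"
  by (subst Cat_eq) simp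

definition inv_quad :: "real fps" where
  "inv_quad = inverse (1 + Cat - Cat\<^sup>2)"

lemma inv_quad: "inv_quad * (1 + Cat - Cat\<^sup>2) = 1"
  unfolding inv_quad_def by (rule inverse_mult_eq_1) (simp add: power2_eq_square)

definition gf :: "real fps" where
  "gf = 1 + (Cat - 1) * (2 - Cat) * inv_quad"

lemma gf_eq:
  "(1 - 5 * fps_X + (1 + fps_X) * sqrt_1_minus_4X) /
   (1 - 5 * fps_X + (1 - fps_X) * sqrt_1_minus_4X) = gf"
proof -
  let ?D = "1 - 5 * fps_X + (1 - fps_X) * sqrt_1_minus_4X"
  \<comment> \<open>The constant term is 2, so the denominator is a unit and the quotient is a true
    inverse.\<close>
  have D0: "fps_nth ?D 0 \<noteq> 0"
    by (simp add: sqrt_eq_Cat)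
  have "1 - 5 * fps_X + (1 + fps_X) * sqrt_1_minus_4X = gf * ?D"
    using Cat_eq inv_quad unfolding sqrt_eq_Cat gf_def by algebra
  then show ?thesis
    using D0 by (simp add: fps_divide_unit mult.assoc inverse_mult_eq_1')
qed

text \<open>The solution of \<open>d\<^sub>i = 1 + x (C\<^sup>i d\<^sub>1 + d\<^sub>2 + \<dots> + d\<^sub>i\<^sub>+\<^sub>1)\<close>, the recurrence for the states with
  \<open>k = i\<close> in each of the first three classes.\<close>

definition diag :: "nat \<Rightarrow> real fps" where
  "diag i = Cat ^ i * (gf + of_nat i * (Cat - 1)\<^sup>2 * inv_quad)"

lemma diag_0 [simp]: "diag 0 = gf"
  by (simp add: diag_def)

lemma diag_Suc_0: "diag (Suc 0) = Cat\<^sup>2 * (2 - Cat) * inv_quad"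
  using inv_quad unfolding diag_def gf_def by simp algebra

text \<open>Equivalently, x d_(i+2) - d_(i+1) + d_i = -x (C - 1) C^i d_1. The right side is a
  multiple of C^i and C is a characteristic root; this resonance explains the factor i in
  \<open>diag\<close>.\<close>

lemma diag_step:
  "diag (Suc i) = diag i + fps_X * ((Cat ^ Suc i - Cat ^ i) * diag 1 + diag (Suc (Suc i)))"
proof -
  \<comment> \<open>\<open>P\<close> stands for C^i and \<open>m\<close> for i, which leaves a
    polynomial identity.\<close>
  have "P * Cat * (gf + (1 + m) * (Cat - 1)\<^sup>2 * inv_quad) =
      P * (gf + m * (Cat - 1)\<^sup>2 * inv_quad) + fps_X * ((Cat * P - P) * (Cat\<^sup>2 * (2 - Cat) * inv_quad) +
        P * Cat * Cat * (gf + (2 + m) * (Cat - 1)\<^sup>2 * inv_quad))" for P m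
    using Cat_eq inv_quad unfolding gf_def by algebra
  from this[of "Cat ^ i" "of_nat i"] show ?thesis
    by (simp add: diag_Suc_0 diag_def[of "Suc (Suc i)"] diag_def[of "Suc i"] diag_def[of i] algebra_simps)
qed

text \<open>Telescopes \<open>diag_step\<close>. The case i = 0, which is d_0 = 1 + x d_1, is the
  boundary condition that determines d_1 and brings in the denominator 1 + C - C^2.\<close>

lemma diag_sum: "diag i = 1 + fps_X * (Cat ^ i * diag 1 + (\<Sum>j=1..i. diag (Suc j)))"
proof (induction i)
  case 0
  show ?case
    using Cat_eq inv_quad by (simp add: diag_Suc_0 gf_def) algebra
next
  case (Suc i)
  show ?case
    by (subst diag_step, subst Suc) (simp add: algebra_simps)
qed

section \<open>The classes of the form \<open>1 \<oplus> T\<close>\<close>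

text \<open>Translates a threshold in the child to one in the parent: entries from \<open>v\<close>
  on were raised, so a threshold above \<open>v\<close> drops by one.\<close>

lemma le_bump_iff: "u \<le> bump v b \<longleftrightarrow> (if u \<le> v then u else u - 1) \<le> b"
  by (auto simp: bump_def)

text \<open>Each pattern in the first three sets is a 1 followed by three larger values. Hence
  \<open>v\<close> is admissible iff the entries \<ge> \<open>v\<close> of \<open>w\<close> avoid
  the three-letter patterns described by \<open>R\<close>.\<close>

definition avoids_above :: "(nat \<Rightarrow> nat \<Rightarrow> nat \<Rightarrow> bool) \<Rightarrow> nat list \<Rightarrow> nat \<Rightarrow> bool" where
  "avoids_above R w u \<longleftrightarrow>
     (\<forall>b c d. before w b c \<longrightarrow> before w c d \<longrightarrow> u \<le> b \<longrightarrow> u \<le> c \<longrightarrow> u \<le> d \<longrightarrow> \<not> R b c d)"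

definition increasing_above :: "nat list \<Rightarrow> nat \<Rightarrow> bool" where
  "increasing_above w u \<longleftrightarrow> (\<forall>b c. before w b c \<longrightarrow> u \<le> b \<longrightarrow> u \<le> c \<longrightarrow> b < c)"

lemma all_before_prepend:
  "(\<forall>b c. before (prepend v w) b c \<longrightarrow> P b c) \<longleftrightarrow>
    (\<forall>b c. before w b c \<longrightarrow> P (bump v b) (bump v c)) \<and> (\<forall>c\<in>set w. P v (bump v c))"
  unfolding before_prepend by blast

lemma all_before_before_prepend:
  "(\<forall>b c d. before (prepend v w) b c \<longrightarrow> before (prepend v w) c d \<longrightarrow> P b c d) \<longleftrightarrow>
    (\<forall>b c d. before w b c \<longrightarrow> before w c d \<longrightarrow> P (bump v b) (bump v c) (bump v d)) \<and>
    (\<forall>c d. before w c d \<longrightarrow> P v (bump v c) (bump v d))" (is "?L \<longleftrightarrow> ?R")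
proof
  assume L: ?L
  have "P (bump v b) (bump v c) (bump v d)" if "before w b c" "before w c d" for b c d
    using L that unfolding before_prepend by blast
  moreover have "P v (bump v c) (bump v d)" if "before w c d" for c d
  proof -
    have "before (prepend v w) v (bump v c)" "before (prepend v w) (bump v c) (bump v d)"
      using that before_in_set unfolding before_prepend by blast+
    then show ?thesis using L by blast
  qed
  ultimately show ?R by blast
next
  assume R: ?R
  show ?L
  proof (intro allI impI)
    fix b c d assume *: "before (prepend v w) b c" "before (prepend v w) c d"
    then obtain c' d' where c: "c = bump v c'" "d = bump v d'" "before w c' d'"
      unfolding before_prepend by auto
    with * consider "b = v" | b' where "b = bump v b'" "before w b' c'"
      unfolding before_prepend by auto
    then show "P b c d"
      using R c by cases auto
  qed
qed

lemma avoids_above_prepend: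
  assumes "\<And>b c d. R (bump v b) (bump v c) (bump v d) \<longleftrightarrow> R b c d"
  shows "avoids_above R (prepend v w) u \<longleftrightarrow>
    avoids_above R w (if u \<le> v then u else u - 1) \<and>
    (u \<le> v \<longrightarrow> (\<forall>b c. before w b c \<longrightarrow> u \<le> b \<longrightarrow> u \<le> c \<longrightarrow> \<not> R v (bump v b) (bump v c)))"
  unfolding avoids_above_def all_before_before_prepend le_bump_iff assms
  by (cases "u \<le> v") simp_all

lemma increasing_above_prepend:
  "increasing_above (prepend v w) u \<longleftrightarrow>
    increasing_above w (if u \<le> v then u else u - 1) \<and> (u \<le> v \<longrightarrow> (\<forall>b\<in>set w. u \<le> b \<longrightarrow> v \<le> b))"
  unfolding increasing_above_def all_before_prepend le_bump_iff
  by (cases "u \<le> v") simp_all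

text \<open>\<open>P u\<close> is a property of the entries \<open>\<ge> u\<close>; \<open>top_level n P k\<close> says that it holds for the \<open>j\<close> largest
  entries exactly if \<open>j \<le> k\<close>.\<close>

definition top_level :: "nat \<Rightarrow> (nat \<Rightarrow> bool) \<Rightarrow> nat \<Rightarrow> bool" where
  "top_level n P k \<longleftrightarrow> k \<le> n \<and> (\<forall>u\<in>{1..Suc n}. P u \<longleftrightarrow> Suc n \<le> u + k)"

lemma top_levelD: "top_level n P k \<Longrightarrow> 1 \<le> u \<Longrightarrow> u \<le> Suc n \<Longrightarrow> P u \<longleftrightarrow> Suc n \<le> u + k"
  by (simp add: top_level_def)

text \<open>\<open>j\<close> is the number of entries above the new one. If these are increasing,
  the new entry in front extends the run by one, and any smaller entry ends it; otherwise the run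
  lies above the new entry and is unchanged.\<close>

lemma increasing_above_prepend_level:
  assumes w: "w \<in> perms n" and i: "top_level n (increasing_above w) i"
    and j: "j \<le> n"
  shows "top_level (Suc n) (increasing_above (prepend (Suc n - j) w)) (if j \<le> i then Suc j else i)"
  unfolding top_level_def
proof (intro conjI ballI)
  show "(if j \<le> i then Suc j else i) \<le> Suc n"
    using i j by (auto simp: top_level_def)
  fix u assume u: "u \<in> {1..Suc (Suc n)}"
  let ?v = "Suc n - j"
  have "increasing_above (prepend ?v w) u \<longleftrightarrow> (if u < ?v then False else if u = ?v then j \<le> i else Suc (Suc n) \<le> u + i)"
  proof (cases u ?v rule: linorder_cases)
    case less
    \<comment> \<open>The entry \<open>u\<close> is smaller than the new first entry and follows
      it.\<close>
    then have "u \<in> set w"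
      using u permsD(2)[OF w] by auto
    then show ?thesis
      using less by (auto simp: increasing_above_prepend)
  next
    case equal
    then show ?thesis
      using top_levelD[OF i, of u] j by (auto simp: increasing_above_prepend)
  next
    case greater
    then show ?thesis
      using top_levelD[OF i, of "u - 1"] u j by (auto simp: increasing_above_prepend)
  qed
  then show "increasing_above (prepend ?v w) u \<longleftrightarrow> Suc (Suc n) \<le> u + (if j \<le> i then Suc j else i)"
    using j u by auto
qed

lemma sum_sites:
  assumes k: "k \<le> n"
  shows "(\<Sum>v | v \<in> {1..Suc n} \<and> Suc n \<le> v + k. H (Suc n - v)) = (\<Sum>j=0..k. H j)"
  by (rule sum.reindex_bij_witness[of _ "\<lambda>j. Suc n - j" "\<lambda>v. Suc n - v"]) (use k in auto)

lemma sites_avoids_above: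
  assumes w: "w \<in> perms n"
    and pat: "\<And>v b c d. pat T v (bump v b) (bump v c) (bump v d) \<longleftrightarrow> v \<le> b \<and> v \<le> c \<and> v \<le> d \<and> R b c d"
    and k: "top_level n (avoids_above R w) k"
  shows "sites T w = {v. v \<in> {1..Suc n} \<and> Suc n \<le> v + k}"
proof -
  have "sites T w = {v \<in> {1..Suc n}. avoids_above R w v}"
    unfolding sites_def pat avoids_above_def permsD(3)[OF w] by blast
  also have "\<dots> = {v. v \<in> {1..Suc n} \<and> Suc n \<le> v + k}"
    using k by (auto simp: top_level_def)
  finally show ?thesis .
qed

text \<open>The state is the pair \<open>(k, i)\<close> of levels of the avoidance property and of an auxiliary property \<open>Q\<close>;
  the child with \<open>j\<close> entries above the new one has state \<open>(K k i j, I k i j)\<close>.\<close>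

lemma avoiders_gf_levels:
  fixes f :: "nat \<Rightarrow> nat \<Rightarrow> real fps"
  assumes T: "\<forall>\<tau>\<in>T. length \<tau> = 4"
    and pat: "\<And>v b c d. pat T v (bump v b) (bump v c) (bump v d) \<longleftrightarrow> v \<le> b \<and> v \<le> c \<and> v \<le> d \<and> R b c d"
    and child: "\<And>n w k i j. w \<in> perms n \<Longrightarrow> top_level n (avoids_above R w) k \<Longrightarrow>
      top_level n (Q n w) i \<Longrightarrow> i \<le> k \<Longrightarrow> n = 0 \<or> 0 < i \<Longrightarrow> j \<le> k \<Longrightarrow>
      top_level (Suc n) (avoids_above R (prepend (Suc n - j) w)) (K k i j) \<and>
      top_level (Suc n) (Q (Suc n) (prepend (Suc n - j) w)) (I k i j) \<and> 
      0 < I k i j \<and> I k i j \<le> K k i j"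
    and Q0: "Q 0 [] 1"
    and f0: "f 0 0 = 1 + fps_X * f (K 0 0 0) (I 0 0 0)"
    and f: "\<And>k i. 0 < i \<Longrightarrow> i \<le> k \<Longrightarrow> f k i = 1 + fps_X * (\<Sum>j=0..k. f (K k i j) (I k i j))"
  shows "avoiders_gf T = f 0 0"
proof (rule avoiders_gf_eqI[OF T])
  let ?S = "\<lambda>w G. \<exists>k i. top_level (length w) (avoids_above R w) k \<and> top_level (length w) (Q (length w) w) i \<and>
      i \<le> k \<and> (length w = 0 \<or> 0 < i) \<and> G = f k i"
  have "top_level 0 (avoids_above R []) 0" "top_level 0 (Q 0 []) 0"
    using Q0 by (auto simp: top_level_def avoids_above_def le_Suc_eq)
  then show "?S [] (f 0 0)"
    by auto
  fix n w G assume w: "w \<in> perms n" and "?S w G"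
  then obtain k i where k: "top_level n (avoids_above R w) k" and i: "top_level n (Q n w) i"
    and ik: "i \<le> k" "n = 0 \<or> 0 < i" and G: "G = f k i"
    using permsD(3)[OF w] by auto
  define H where "H v = f (K k i (Suc n - v)) (I k i (Suc n - v))" for v
  have kn: "k \<le> n"
    using k by (simp add: top_level_def)
  have s: "sites T w = {v. v \<in> {1..Suc n} \<and> Suc n \<le> v + k}"
    by (rule sites_avoids_above[OF w pat k])
  have "f k i = 1 + fps_X * (\<Sum>j=0..k. f (K k i j) (I k i j))"
  \<comment> \<open>i = 0 happens only for the empty permutation, where k = 0 too; there
    \<open>f0\<close> takes the place of the general recurrence.\<close>
  proof (cases "0 < i")
    case False
    then have "i = 0" "k = 0" using ik kn by auto
    then show ?thesis using f0 by simp
  qed (use f ik in blast)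
  then have "G = 1 + fps_X * (\<Sum>v\<in>sites T w. H v)"
    unfolding s H_def G sum_sites[OF kn, of "\<lambda>j. f (K k i j) (I k i j)"] .
  moreover have "?S (prepend v w) (H v)" if "v \<in> sites T w" for v
  proof -
    have v: "v = Suc n - (Suc n - v)" "Suc n - v \<le> k"
      using that by (auto simp: s)
    show ?thesis
      using child[OF w k i ik v(2), folded v(1)] unfolding length_prepend permsD(3)[OF w] H_def by blast
  qed
  ultimately show "\<exists>H. G = 1 + fps_X * (\<Sum>v\<in>sites T w. H v) \<and> (\<forall>v\<in>sites T w. ?S (prepend v w) (H v))"
    by blast
qed

section \<open>The individual classes \<open>Pi3\<close>, \<open>Pi2\<close>,
  \<open>Pi1\<close>\<close>

lemma order_isomorphic_patterns:
  "order_isomorphic [a, b, c, d] [1, 2, 3, 4] \<longleftrightarrow> a < b \<and> b < c \<and> c < d"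
  "order_isomorphic [a, b, c, d] [1, 2, 4, 3] \<longleftrightarrow> a < b \<and> b < d \<and> d < c"
  "order_isomorphic [a, b, c, d] [1, 3, 2, 4] \<longleftrightarrow> a < c \<and> c < b \<and> b < d"
  "order_isomorphic [a, b, c, d] [1, 3, 4, 2] \<longleftrightarrow> a < d \<and> d < b \<and> b < c"
  "order_isomorphic [a, b, c, d] [1, 4, 2, 3] \<longleftrightarrow> a < c \<and> c < d \<and> d < b"
  "order_isomorphic [a, b, c, d] [1, 4, 3, 2] \<longleftrightarrow> a < d \<and> d < c \<and> c < b"
  "order_isomorphic [a, b, c, d] [3, 1, 2, 4] \<longleftrightarrow> b < c \<and> c < a \<and> a < d"
  "order_isomorphic [a, b, c, d] [4, 1, 2, 3] \<longleftrightarrow> b < c \<and> c < d \<and> d < a"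
  "order_isomorphic [a, b, c, d] [4, 1, 3, 2] \<longleftrightarrow> b < d \<and> d < c \<and> c < a"
  by (simp_all add: order_isomorphic_4) linarith+

lemma pat_Pi1:
  "pat Pi1 v (bump v b) (bump v c) (bump v d) \<longleftrightarrow>
    v \<le> b \<and> v \<le> c \<and> v \<le> d \<and> (b < c \<and> c < d \<or> b < d \<and> d < c \<or> d < b \<and> b < c)"
  unfolding pat_def Pi1_def by (simp add: order_isomorphic_patterns del: One_nat_def) linarith

lemma pat_Pi2:
  "pat Pi2 v (bump v b) (bump v c) (bump v d) \<longleftrightarrow>
    v \<le> b \<and> v \<le> c \<and> v \<le> d \<and> (b < d \<and> d < c \<or> c < b \<and> b < d \<or> d < b \<and> b < c)"
  unfolding pat_def Pi2_def by (simp add: order_isomorphic_patterns del: One_nat_def) linarith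

lemma pat_Pi3:
  "pat Pi3 v (bump v b) (bump v c) (bump v d) \<longleftrightarrow>
    v \<le> b \<and> v \<le> c \<and> v \<le> d \<and> (c < b \<and> b < d \<or> d < b \<and> b < c \<or> d < c \<and> c < b)"
  unfolding pat_def Pi3_def by (simp add: order_isomorphic_patterns del: One_nat_def) linarith

text \<open>A new maximum can only start a 321, so what follows has to increase. Any other new entry
  is harmless as the minimum of the range, but completes a 213 or 231 as soon as one smaller value
  is included.\<close>

lemma Pi3_level:
  assumes w: "w \<in> perms n" and k: "top_level n (avoids_above R w) k"
    and i: "top_level n (increasing_above w) i" and ik: "i \<le> k" and j: "j \<le> k"
    and R: "R = (\<lambda>b c d. c < b \<and> b < d \<or> d < b \<and> b < c \<or> d < c \<and> c < b)"
  shows "top_level (Suc n) (avoids_above R (prepend (Suc n - j) w)) (if j = 0 then Suc i else Suc j)"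
  unfolding top_level_def
proof (intro conjI ballI)
  have kn: "k \<le> n"
    using k by (simp add: top_level_def)
  then show "(if j = 0 then Suc i else Suc j) \<le> Suc n"
    using ik j by auto
  fix u assume u: "u \<in> {1..Suc (Suc n)}"
  let ?v = "Suc n - j"
  have pre: "avoids_above R (prepend ?v w) u \<longleftrightarrow>
    avoids_above R w (if u \<le> ?v then u else u - 1) \<and>
    (u \<le> ?v \<longrightarrow> (\<forall>b c. before w b c \<longrightarrow> u \<le> b \<longrightarrow> u \<le> c \<longrightarrow> \<not> R ?v (bump ?v b) (bump ?v c)))"
    by (rule avoids_above_prepend) (auto simp: R)
  have set: "before w b c \<Longrightarrow> b \<in> {1..n} \<and> c \<in> {1..n} \<and> b \<noteq> c" for b c
    using before_in_set[of w b c] before_neq[of w b c] permsD[OF w] by auto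
  show "avoids_above R (prepend ?v w) u \<longleftrightarrow> Suc (Suc n) \<le> u + (if j = 0 then Suc i else Suc j)"
  proof (cases "u \<le> ?v")
    case False
    then show ?thesis
      using pre top_levelD[OF k, of "u - 1"] u j kn by auto
  next
    case True
    show ?thesis
    proof (cases "j = 0")
      case j0: True
      have "(\<forall>b c. before w b c \<longrightarrow> u \<le> b \<longrightarrow> u \<le> c \<longrightarrow> \<not> R ?v (bump ?v b) (bump ?v c)) \<longleftrightarrow>
          increasing_above w u"
        unfolding increasing_above_def R j0 using set by (fastforce simp: not_less)
      then show ?thesis
        using pre True j0 top_levelD[OF i, of u] top_levelD[OF k, of u] u ik by auto
    next
      case False
      show ?thesis
      proof (cases "u = ?v")
        case True
        then show ?thesis
          using pre False top_levelD[OF k, of u] u j kn unfolding R by auto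
      next
        case neq: False
        \<comment> \<open>These two old values end up directly below and directly above the new
          entry; one order yields 213, the other 231.\<close>
        then have "?v - 1 \<in> set w" "?v \<in> set w" "?v - 1 \<noteq> ?v" "u \<le> ?v - 1"
          using True u False j kn permsD(2)[OF w] by auto
        then have "\<exists>b c. before w b c \<and> u \<le> b \<and> u \<le> c \<and> R ?v (bump ?v b) (bump ?v c)"
          using before_total[of "?v - 1" w ?v] unfolding R by force
        then show ?thesis
          using pre True neq False by auto
      qed
    qed
  qed
qed

text \<open>Telescopes, since C^(p+1) - C^p = x C^(p+2).\<close>

lemma sum_Cat_powers: "i \<le> k \<Longrightarrow> fps_X * (\<Sum>j=Suc i..k. Cat ^ (Suc j - i)) = Cat ^ (k - i) - 1"
proof (induction k rule: dec_induct)
  case (step k)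
  have "Cat ^ (Suc k - i) = Cat ^ (k - i) + fps_X * Cat ^ (Suc (Suc k) - i)"
  proof -
    have "Cat * P = P + fps_X * (Cat * (Cat * P))" for P
      using Cat_eq by algebra
    then show ?thesis
      using step(1) by (simp add: Suc_diff_le)
  qed
  then show ?case
    using step by (simp add: distrib_left)
qed simp

lemma sum_split_at:
  fixes g :: "nat \<Rightarrow> 'a :: comm_monoid_add"
  assumes "i \<le> k"
  shows "(\<Sum>j=0..k. g j) = g 0 + ((\<Sum>j=1..i. g j) + (\<Sum>j=Suc i..k. g j))"
proof -
  obtain p where p: "k = i + p"
    using assms le_Suc_ex by blast
  have "(\<Sum>j=1..k. g j) = (\<Sum>j=1..i. g j) + (\<Sum>j=Suc i..k. g j)"
    unfolding p by (subst sum.ub_add_nat) simp_all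
  then show ?thesis
    by (simp add: sum.atLeast_Suc_atMost)
qed

lemma avoiders_gf_Pi3: "avoiders_gf Pi3 = gf"
proof -
  let ?R = "\<lambda>b c d. c < b \<and> b < d \<or> d < b \<and> b < c \<or> d < c \<and> c < b"
  \<comment> \<open>The children with i < j \<le> k keep \<open>i\<close>. By
    \<open>sum_Cat_powers\<close> they contribute (C^(k-i) - 1) d_i, which accounts for the factor;
    the remaining children form the recurrence of \<open>diag\<close>.\<close>
  let ?f = "\<lambda>k i. Cat ^ (k - i) * diag i"
  let ?K = "\<lambda>k i j. if j = 0 then Suc i else Suc j"
  let ?I = "\<lambda>k i j. if j \<le> i then Suc j else i"
  have "avoiders_gf Pi3 = ?f 0 0"
  proof (rule avoiders_gf_levels[OF _ pat_Pi3, where f = ?f and K = ?K and I = ?I and Q = "\<lambda>_. increasing_above"])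
    show "\<forall>\<tau>\<in>Pi3. length \<tau> = 4"
      by (simp add: Pi3_def)
  next
    fix n w k i j assume *: "w \<in> perms n"
      "top_level n (avoids_above ?R w) k"
      "top_level n (increasing_above w) i" "i \<le> k" "n = 0 \<or> 0 < i" "j \<le> k"
    then show "top_level (Suc n) (avoids_above ?R (prepend (Suc n - j) w)) (?K k i j) \<and>
       top_level (Suc n) (increasing_above (prepend (Suc n - j) w)) (?I k i j) \<and>
       0 < ?I k i j \<and> ?I k i j \<le> ?K k i j"
      using Pi3_level[OF *(1-4,6) refl] increasing_above_prepend_level[OF *(1,3), of j]
      by (auto simp: top_level_def[of n])
  next
    show "increasing_above [] 1"
      by (simp add: increasing_above_def)
    show "?f 0 0 = 1 + fps_X * ?f (?K 0 0 0) (?I 0 0 0)"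
      using diag_sum[of 0] by simp
  next
    fix k i :: nat assume ik: "0 < i" "i \<le> k"
    have "(\<Sum>j=0..k. ?f (?K k i j) (?I k i j)) = ?f (?K k i 0) (?I k i 0) +
      ((\<Sum>j=1..i. ?f (?K k i j) (?I k i j)) + (\<Sum>j=Suc i..k. ?f (?K k i j) (?I k i j)))"
      by (rule sum_split_at[OF ik(2)])
    also have "?f (?K k i 0) (?I k i 0) = Cat ^ i * diag 1"
      by simp
    also have "(\<Sum>j=1..i. ?f (?K k i j) (?I k i j)) = (\<Sum>j=1..i. diag (Suc j))"
      by (intro sum.cong) auto
    also have "(\<Sum>j=Suc i..k. ?f (?K k i j) (?I k i j)) = (\<Sum>j=Suc i..k. Cat ^ (Suc j - i)) * diag i"
      unfolding sum_distrib_right by (intro sum.cong) auto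
    finally have sum: "(\<Sum>j=0..k. ?f (?K k i j) (?I k i j)) = Cat ^ i * diag 1 +
      ((\<Sum>j=1..i. diag (Suc j)) + (\<Sum>j=Suc i..k. Cat ^ (Suc j - i)) * diag i)" .
    have "P * d = 1 + fps_X * (A + (B + S * d))"
      if "d = 1 + fps_X * (A + B)" "fps_X * S = P - 1" for d A B S P :: "real fps"
      using that by algebra
    from this[OF diag_sum[of i] sum_Cat_powers[OF ik(2)]]
    show "?f k i = 1 + fps_X * (\<Sum>j=0..k. ?f (?K k i j) (?I k i j))"
      unfolding sum .
  qed
  then show ?thesis by simp
qed

text \<open>A new maximum starts none of 132, 213, 231. A new minimum of the range starts a 132 iff
  the entries above it have a descent, and any smaller value gives a 213 or 231 as for
  \<open>Pi3\<close>.\<close>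

lemma Pi2_level:
  assumes w: "w \<in> perms n" and k: "top_level n (avoids_above R w) k"
    and i: "top_level n (increasing_above w) i" and ik: "i \<le> k" and j: "j \<le> k"
    and R: "R = (\<lambda>b c d. b < d \<and> d < c \<or> c < b \<and> b < d \<or> d < b \<and> b < c)"
  shows "top_level (Suc n) (avoids_above R (prepend (Suc n - j) w))
    (if j = 0 then Suc k else if j \<le> i then Suc j else j)"
  unfolding top_level_def
proof (intro conjI ballI)
  have kn: "k \<le> n"
    using k by (simp add: top_level_def)
  then show "(if j = 0 then Suc k else if j \<le> i then Suc j else j) \<le> Suc n"
    using ik j by auto
  fix u assume u: "u \<in> {1..Suc (Suc n)}"
  let ?v = "Suc n - j"
  have pre: "avoids_above R (prepend ?v w) u \<longleftrightarrow>
    avoids_above R w (if u \<le> ?v then u else u - 1) \<and>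
    (u \<le> ?v \<longrightarrow> (\<forall>b c. before w b c \<longrightarrow> u \<le> b \<longrightarrow> u \<le> c \<longrightarrow> \<not> R ?v (bump ?v b) (bump ?v c)))"
    by (rule avoids_above_prepend) (auto simp: R)
  have set: "before w b c \<Longrightarrow> b \<in> {1..n} \<and> c \<in> {1..n} \<and> b \<noteq> c" for b c
    using before_in_set[of w b c] before_neq[of w b c] permsD[OF w] by auto
  show "avoids_above R (prepend ?v w) u \<longleftrightarrow>
    Suc (Suc n) \<le> u + (if j = 0 then Suc k else if j \<le> i then Suc j else j)"
  proof (cases "u \<le> ?v")
    case False
    then show ?thesis
      using pre top_levelD[OF k, of "u - 1"] u j kn by auto
  next
    case True
    show ?thesis
    proof (cases "j = 0")
      case j0: True
      have "\<forall>b c. before w b c \<longrightarrow> u \<le> b \<longrightarrow> u \<le> c \<longrightarrow> \<not> R ?v (bump ?v b) (bump ?v c)"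
        unfolding R j0 using set by fastforce
      then show ?thesis
        using pre True j0 top_levelD[OF k, of u] u by auto
    next
      case False
      show ?thesis
      proof (cases "u = ?v")
        case True
        have "(\<forall>b c. before w b c \<longrightarrow> u \<le> b \<longrightarrow> u \<le> c \<longrightarrow> \<not> R ?v (bump ?v b) (bump ?v c)) \<longleftrightarrow>
            increasing_above w u"
          unfolding increasing_above_def R True using set by (fastforce simp: not_less)
        then show ?thesis
          using pre True False top_levelD[OF k, of u] top_levelD[OF i, of u] u j kn by auto
      next
        case neq: False
        then have "?v - 1 \<in> set w" "?v \<in> set w" "?v - 1 \<noteq> ?v" "u \<le> ?v - 1"
          using True u False j kn permsD(2)[OF w] by auto
        then have "\<exists>b c. before w b c \<and> u \<le> b \<and> u \<le> c \<and> R ?v (bump ?v b) (bump ?v c)"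
          using before_total[of "?v - 1" w ?v] unfolding R by force
        then show ?thesis
          using pre True neq False by auto
      qed
    qed
  qed
qed

text \<open>Among the entries \<ge> \<open>u\<close>, those other than \<open>n\<close> decrease and
  \<open>n\<close> comes last. This is the condition under which a new second largest entry creates
  no pattern of \<open>Pi1\<close>.\<close>

definition decreasing_but_max_above :: "nat \<Rightarrow> nat list \<Rightarrow> nat \<Rightarrow> bool" where
  "decreasing_but_max_above n w u \<longleftrightarrow>
     (\<forall>b c. before w b c \<longrightarrow> u \<le> b \<longrightarrow> u \<le> c \<longrightarrow> b \<noteq> n \<and> (c < b \<or> c = n))"

lemma decreasing_but_max_above_prepend:
  "decreasing_but_max_above (Suc n) (prepend v w) u \<longleftrightarrow>
    (\<forall>b c. before w b c \<longrightarrow> (if u \<le> v then u else u - 1) \<le> b \<longrightarrow> (if u \<le> v then u else u - 1) \<le> c \<longrightarrow>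
      bump v b \<noteq> Suc n \<and> (c < b \<or> bump v c = Suc n)) \<and>
    (u \<le> v \<longrightarrow> (\<forall>c\<in>set w. u \<le> c \<longrightarrow> v \<noteq> Suc n \<and> (c < v \<or> bump v c = Suc n)))"
  unfolding decreasing_but_max_above_def all_before_prepend le_bump_iff
  by (cases "u \<le> v") simp_all

lemma decreasing_but_max_above_prepend_level:
  assumes w: "w \<in> perms n" and i: "top_level n (decreasing_but_max_above n w) i"
    and i0: "n = 0 \<or> 0 < i" and j: "j \<le> n"
  shows "top_level (Suc n) (decreasing_but_max_above (Suc n) (prepend (Suc n - j) w))
    (if j = 0 then 1 else if j = 1 then Suc i else min i j)"
  unfolding top_level_def
proof (intro conjI ballI)
  show "(if j = 0 then 1 else if j = 1 then Suc i else min i j) \<le> Suc n"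
    using i j by (auto simp: top_level_def)
  fix u assume u: "u \<in> {1..Suc (Suc n)}"
  let ?v = "Suc n - j"
  have set: "before w b c \<Longrightarrow> b \<in> {1..n} \<and> c \<in> {1..n} \<and> b \<noteq> c" for b c
    using before_in_set[of w b c] before_neq[of w b c] permsD[OF w] by auto
  show "decreasing_but_max_above (Suc n) (prepend ?v w) u \<longleftrightarrow>
    Suc (Suc n) \<le> u + (if j = 0 then 1 else if j = 1 then Suc i else min i j)"
  proof (cases "j = 0")
    case True
    have "decreasing_but_max_above (Suc n) (prepend ?v w) u \<longleftrightarrow> n < u"
    proof
      assume "decreasing_but_max_above (Suc n) (prepend ?v w) u"
      then show "n < u"
        using True u permsD(2)[OF w] by (auto simp: decreasing_but_max_above_prepend not_less)
    next
      assume "n < u"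
      then show "decreasing_but_max_above (Suc n) (prepend ?v w) u"
        using True set permsD(2)[OF w] by (fastforce simp: decreasing_but_max_above_prepend bump_def)
    qed
    then show ?thesis
      using True u by auto
  next
    case False
    have bump: "bump ?v b = Suc n \<longleftrightarrow> b = n" if "b \<in> {1..n}" for b
      using that False by (auto simp: bump_def)
    have pre: "decreasing_but_max_above (Suc n) (prepend ?v w) u \<longleftrightarrow>
      decreasing_but_max_above n w (if u \<le> ?v then u else u - 1) \<and>
      (u \<le> ?v \<longrightarrow> (\<forall>c\<in>{1..n}. u \<le> c \<longrightarrow> c < ?v \<or> c = n))"
    proof -
      have "(\<forall>b c. before w b c \<longrightarrow> t \<le> b \<longrightarrow> t \<le> c \<longrightarrow> bump ?v b \<noteq> Suc n \<and> (c < b \<or> bump ?v c = Suc n))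
          \<longleftrightarrow> decreasing_but_max_above n w t" for t
        unfolding decreasing_but_max_above_def using set bump by metis
      then show ?thesis
        unfolding decreasing_but_max_above_prepend permsD(2)[OF w] using bump False j by auto
    qed
    show ?thesis
    proof (cases "j = 1")
      case True
      then show ?thesis
        using pre top_levelD[OF i, of u] top_levelD[OF i, of "u - 1"] i0 u j by auto
    next
      case j2: False
      show ?thesis
      proof (cases "u \<le> ?v")
        case True
        \<comment> \<open>The witness is the old value \<open>?v\<close>: it is raised above the new
          entry, follows it, and is not the maximum because \<open>j\<close> is at least 2.\<close>
        then have "?v \<in> {1..n} \<and> u \<le> ?v \<and> \<not> (?v < ?v \<or> ?v = n)"
          using False j2 j by auto
        then have "\<not> decreasing_but_max_above (Suc n) (prepend ?v w) u"
          using pre by blast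
        then show ?thesis
          using True False j2 j by auto
      next
        case False
        then show ?thesis
          using pre top_levelD[OF i, of "u - 1"] u j j2 \<open>j \<noteq> 0\<close> by auto
      qed
    qed
  qed
qed

text \<open>A new maximum starts none of 123, 132, 231. A new entry with two larger ones after it
  starts a 123 or 132. In the remaining case j = 1 the only danger is a 231 through the maximum,
  which must therefore come last.\<close>

lemma Pi1_level:
  assumes w: "w \<in> perms n" and k: "top_level n (avoids_above R w) k"
    and i: "top_level n (decreasing_but_max_above n w) i" and ik: "i \<le> k" and j: "j \<le> k"
    and R: "R = (\<lambda>b c d. b < c \<and> c < d \<or> b < d \<and> d < c \<or> d < b \<and> b < c)"
  shows "top_level (Suc n) (avoids_above R (prepend (Suc n - j) w))
    (if j = 0 then Suc k else if j = 1 then Suc i else j)"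
  unfolding top_level_def
proof (intro conjI ballI)
  have kn: "k \<le> n"
    using k by (simp add: top_level_def)
  then show "(if j = 0 then Suc k else if j = 1 then Suc i else j) \<le> Suc n"
    using ik j by auto
  fix u assume u: "u \<in> {1..Suc (Suc n)}"
  let ?v = "Suc n - j"
  have pre: "avoids_above R (prepend ?v w) u \<longleftrightarrow>
    avoids_above R w (if u \<le> ?v then u else u - 1) \<and>
    (u \<le> ?v \<longrightarrow> (\<forall>b c. before w b c \<longrightarrow> u \<le> b \<longrightarrow> u \<le> c \<longrightarrow> \<not> R ?v (bump ?v b) (bump ?v c)))"
    by (rule avoids_above_prepend) (auto simp: R)
  have set: "before w b c \<Longrightarrow> b \<in> {1..n} \<and> c \<in> {1..n} \<and> b \<noteq> c" for b c
    using before_in_set[of w b c] before_neq[of w b c] permsD[OF w] by auto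
  show "avoids_above R (prepend ?v w) u \<longleftrightarrow>
    Suc (Suc n) \<le> u + (if j = 0 then Suc k else if j = 1 then Suc i else j)"
  proof (cases "u \<le> ?v")
    case False
    then show ?thesis
      using pre top_levelD[OF k, of "u - 1"] u j kn by auto
  next
    case True
    consider "j = 0" | "j = 1" | "2 \<le> j" by linarith
    then show ?thesis
    proof cases
      case 1
      have "\<forall>b c. before w b c \<longrightarrow> u \<le> b \<longrightarrow> u \<le> c \<longrightarrow> \<not> R ?v (bump ?v b) (bump ?v c)"
        unfolding R 1 using set by fastforce
      then show ?thesis
        using pre True 1 top_levelD[OF k, of u] u by auto
    next
      case 2
      have "avoids_above R (prepend ?v w) u \<longleftrightarrow> decreasing_but_max_above n w u"
      proof
        assume *: "avoids_above R (prepend ?v w) u"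
        have last: "\<not> before w n c" if "u \<le> c" for c
        proof
          assume "before w n c"
          then have "R ?v (bump ?v n) (bump ?v c)" "u \<le> n"
            using set 2 True unfolding R by fastforce+
          then show False
            using * pre True that \<open>before w n c\<close> by blast
        qed
        show "decreasing_but_max_above n w u"
          unfolding decreasing_but_max_above_def
        proof (intro allI impI)
          fix b c assume bc: "before w b c" "u \<le> b" "u \<le> c"
          \<comment> \<open>Since \<open>n\<close> comes after \<open>c\<close>, a rise from
            \<open>b\<close> to \<open>c\<close> below \<open>n\<close> would be completed to a
            123.\<close>
          have "c < b \<or> c = n"
          proof (rule ccontr)
            assume "\<not> (c < b \<or> c = n)"
            then have "b < c" "c < n"
              using set[OF bc(1)] by auto
            then have "before w c n"
              using before_total[of c w n] set[OF bc(1)] last[OF bc(3)] permsD(2)[OF w] by auto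
            moreover have "avoids_above R w u"
              using * pre True by simp
            ultimately show False
              using bc \<open>b < c\<close> \<open>c < n\<close> unfolding avoids_above_def R by (meson less_imp_le order_trans)
          qed
          then show "b \<noteq> n \<and> (c < b \<or> c = n)"
            using last bc by blast
        qed
      next
        assume *: "decreasing_but_max_above n w u"
        have "u \<le> Suc n" "1 \<le> u"
          using True u by auto
        then have "avoids_above R w u"
          using * top_levelD[OF i, of u] top_levelD[OF k, of u] ik by simp
        moreover have "\<not> R ?v (bump ?v b) (bump ?v c)" if "before w b c" "u \<le> b" "u \<le> c" for b c
        proof -
          have "b < n"
            using * that set[OF that(1)] unfolding decreasing_but_max_above_def by fastforce
          then show ?thesis
            using 2 kn j unfolding R by auto
        qed
        ultimately show "avoids_above R (prepend ?v w) u"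
          using pre True by simp
      qed
      then show ?thesis
        using 2 top_levelD[OF i, of u] u True by auto
    next
      case 3
      then have "n \<in> set w" "?v \<in> set w" "n \<noteq> ?v" "u \<le> n" "?v \<le> n"
        using True u j kn permsD(2)[OF w] by auto
      then have "\<exists>b c. before w b c \<and> u \<le> b \<and> u \<le> c \<and> R ?v (bump ?v b) (bump ?v c)"
        using before_total[of n w ?v] True unfolding R by force
      then show ?thesis
        using pre True 3 j kn u by auto
    qed
  qed
qed

section \<open>Series shared by \<open>Pi2\<close> and \<open>Pi1\<close>\<close>

definition geom :: "real fps" where
  "geom = inverse (1 - fps_X)"

lemma geom: "geom = 1 + fps_X * geom"
proof -
  have "geom * (1 - fps_X) = 1"
    unfolding geom_def by (rule inverse_mult_eq_1) simp
  then show ?thesis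
    by (simp add: algebra_simps)
qed

text \<open>For fixed \<open>i\<close> the recurrence in \<open>k\<close> is \<open>(1 - x) f k = f (k - 1) + x (C - 1) \<delta> C\<^sup>k\<close> with
  \<open>\<delta> = C (2 - C) / (1 + C - C\<^sup>2)\<close>; \<open>\<delta> C\<^sup>k\<close> is a particular solution.\<close>

definition off_diag :: "nat \<Rightarrow> nat \<Rightarrow> real fps" where
  "off_diag k i = Cat * (2 - Cat) * inv_quad * Cat ^ k +
     (diag i - Cat * (2 - Cat) * inv_quad * Cat ^ i) * geom ^ (k - i)"

lemma off_diag_same [simp]: "off_diag i i = diag i"
  by (simp add: off_diag_def)

text \<open>For i = 1 the starting value d_1 equals \<delta> C, so the homogeneous part
  vanishes.\<close>

lemma off_diag_1: "off_diag k 1 = Cat * (2 - Cat) * inv_quad * Cat ^ k"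
  by (simp add: off_diag_def diag_Suc_0 power2_eq_square algebra_simps)

lemma off_diag_sum:
  assumes "i \<le> k"
  shows "off_diag k i = 1 + fps_X * (off_diag (Suc k) 1 + ((\<Sum>j=1..i. diag (Suc j)) + (\<Sum>j=Suc i..k. off_diag j i)))"
  using assms
proof (induction k rule: dec_induct)
  case base
  have "off_diag (Suc i) 1 = Cat ^ i * diag 1"
    by (simp only: off_diag_1) (simp add: diag_Suc_0 power2_eq_square algebra_simps)
  then show ?case
    using diag_sum[of i] by simp
next
  case (step k)
  define D where "D = Cat * (2 - Cat) * inv_quad"
  define E where "E = diag i - D * Cat ^ i"
  have "D * (Cat * P) + E * (geom * Q) =
      D * P + E * Q + fps_X * (D * (Cat * (Cat * P)) - D * (Cat * P) + (D * (Cat * P) + E * (geom * Q)))" for P Q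
    using Cat_eq geom by algebra
  note eq = this[of "Cat ^ k" "geom ^ (k - i)"]
  have f: "off_diag k i = D * Cat ^ k + E * geom ^ (k - i)"
    "off_diag (Suc k) i = D * (Cat * Cat ^ k) + E * (geom * geom ^ (k - i))"
    using step(1) by (simp_all add: off_diag_def D_def E_def Suc_diff_le)
  have f1: "off_diag (Suc k) 1 = D * (Cat * Cat ^ k)" "off_diag (Suc (Suc k)) 1 = D * (Cat * (Cat * Cat ^ k))"
    unfolding off_diag_1 D_def by simp_all
  have "off_diag (Suc k) i = off_diag k i +
      fps_X * (off_diag (Suc (Suc k)) 1 - off_diag (Suc k) 1 + off_diag (Suc k) i)"
    unfolding f f1 by (rule eq)
  then show ?case
    using step by (simp add: algebra_simps)
qed

lemma avoiders_gf_Pi2: "avoiders_gf Pi2 = gf"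
proof -
  let ?R = "\<lambda>b c d. b < d \<and> d < c \<or> c < b \<and> b < d \<or> d < b \<and> b < c"
  let ?K = "\<lambda>k i j. if j = 0 then Suc k else if j \<le> i then Suc j else j"
  let ?I = "\<lambda>k i j. if j \<le> i then Suc j else i"
  have "avoiders_gf Pi2 = off_diag 0 0"
  proof (rule avoiders_gf_levels[OF _ pat_Pi2, where f = off_diag and K = ?K and I = ?I
        and Q = "\<lambda>_. increasing_above"])
    show "\<forall>\<tau>\<in>Pi2. length \<tau> = 4"
      by (simp add: Pi2_def)
  next
    fix n w k i j assume *: "w \<in> perms n" "top_level n (avoids_above ?R w) k"
      "top_level n (increasing_above w) i" "i \<le> k" "n = 0 \<or> 0 < i" "j \<le> k"
    then show "top_level (Suc n) (avoids_above ?R (prepend (Suc n - j) w)) (?K k i j) \<and>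
       top_level (Suc n) (increasing_above (prepend (Suc n - j) w)) (?I k i j) \<and>
       0 < ?I k i j \<and> ?I k i j \<le> ?K k i j"
      using Pi2_level[OF *(1-4,6) refl] increasing_above_prepend_level[OF *(1,3), of j]
      by (auto simp: top_level_def[of n])
  next
    show "increasing_above [] 1"
      by (simp add: increasing_above_def)
    show "off_diag 0 0 = 1 + fps_X * off_diag (?K 0 0 0) (?I 0 0 0)"
      using diag_sum[of 0] by simp
  next
    fix k i :: nat assume ik: "0 < i" "i \<le> k"
    have "(\<Sum>j=0..k. off_diag (?K k i j) (?I k i j)) = off_diag (?K k i 0) (?I k i 0) +
      ((\<Sum>j=1..i. off_diag (?K k i j) (?I k i j)) + (\<Sum>j=Suc i..k. off_diag (?K k i j) (?I k i j)))"
      by (rule sum_split_at[OF ik(2)])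
    also have "\<dots> = off_diag (Suc k) 1 + ((\<Sum>j=1..i. diag (Suc j)) + (\<Sum>j=Suc i..k. off_diag j i))"
      by (intro arg_cong2[of _ _ _ _ "(+)"] sum.cong) auto
    finally show "off_diag k i = 1 + fps_X * (\<Sum>j=0..k. off_diag (?K k i j) (?I k i j))"
      using off_diag_sum[OF ik(2)] by simp
  qed
  then show ?thesis by simp
qed

text \<open>The series of \<open>Pi2\<close> work again: there the children j = 1, ..., i have
  diagonal states 2, ..., i + 1 in order, here j = 1 has state i + 1 and j = 2, ..., i have state j.
  The other children agree.\<close>

lemma avoiders_gf_Pi1: "avoiders_gf Pi1 = gf"
proof -
  let ?R = "\<lambda>b c d. b < c \<and> c < d \<or> b < d \<and> d < c \<or> d < b \<and> b < c"
  let ?K = "\<lambda>k i j. if j = 0 then Suc k else if j = 1 then Suc i else j"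
  let ?I = "\<lambda>k i j. if j = 0 then 1 else if j = 1 then Suc i else min i j"
  have "avoiders_gf Pi1 = off_diag 0 0"
  proof (rule avoiders_gf_levels[OF _ pat_Pi1, where f = off_diag and K = ?K and I = ?I
        and Q = decreasing_but_max_above])
    show "\<forall>\<tau>\<in>Pi1. length \<tau> = 4"
      by (simp add: Pi1_def)
  next
    fix n w k i j assume *: "w \<in> perms n" "top_level n (avoids_above ?R w) k"
      "top_level n (decreasing_but_max_above n w) i" "i \<le> k" "n = 0 \<or> 0 < i" "j \<le> k"
    then show "top_level (Suc n) (avoids_above ?R (prepend (Suc n - j) w)) (?K k i j) \<and>
       top_level (Suc n) (decreasing_but_max_above (Suc n) (prepend (Suc n - j) w)) (?I k i j) \<and>
       0 < ?I k i j \<and> ?I k i j \<le> ?K k i j"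
      using Pi1_level[OF *(1-4,6) refl] decreasing_but_max_above_prepend_level[OF *(1,3,5), of j]
      by (auto simp: top_level_def[of n])
  next
    show "decreasing_but_max_above 0 [] 1"
      by (simp add: decreasing_but_max_above_def)
    show "off_diag 0 0 = 1 + fps_X * off_diag (?K 0 0 0) (?I 0 0 0)"
      using diag_sum[of 0] by simp
  next
    fix k i :: nat assume ik: "0 < i" "i \<le> k"
    have "(\<Sum>j=1..i. off_diag (?K k i j) (?I k i j)) =
        off_diag (?K k i 1) (?I k i 1) + (\<Sum>j=Suc 1..i. off_diag (?K k i j) (?I k i j))"
      using ik by (intro sum.atLeast_Suc_atMost) simp
    also have "(\<Sum>j=Suc 1..i. off_diag (?K k i j) (?I k i j)) = (\<Sum>j=Suc 1..i. diag j)"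
      by (intro sum.cong) auto
    also have "off_diag (?K k i 1) (?I k i 1) + (\<Sum>j=Suc 1..i. diag j) = (\<Sum>j=Suc 1..Suc i. diag j)"
      using ik by simp
    also have "\<dots> = (\<Sum>j=1..i. diag (Suc j))"
      by (rule sum.shift_bounds_cl_Suc_ivl)
    finally have "(\<Sum>j=1..i. off_diag (?K k i j) (?I k i j)) = (\<Sum>j=1..i. diag (Suc j))" .
    moreover have "(\<Sum>j=0..k. off_diag (?K k i j) (?I k i j)) = off_diag (?K k i 0) (?I k i 0) +
      ((\<Sum>j=1..i. off_diag (?K k i j) (?I k i j)) + (\<Sum>j=Suc i..k. off_diag (?K k i j) (?I k i j)))"
      by (rule sum_split_at[OF ik(2)])
    moreover have "(\<Sum>j=Suc i..k. off_diag (?K k i j) (?I k i j)) = (\<Sum>j=Suc i..k. off_diag j i)"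
      using ik by (intro sum.cong) auto
    ultimately show "off_diag k i = 1 + fps_X * (\<Sum>j=0..k. off_diag (?K k i j) (?I k i j))"
      using off_diag_sum[OF ik(2)] by simp
  qed
  then show ?thesis by simp
qed

section \<open>The class of \<open>\<Pi>\<^sub>4\<close>\<close>

text \<open>The reversed patterns 4132, 4123 and 3124 differ only in where the last entry lies above
  \<open>c\<close>, so together they leave its place free.\<close>

lemma pat_rev_Pi4:
  "pat (rev ` Pi4) v (bump v c) (bump v b) (bump v a) \<longleftrightarrow> c < b \<and> b < v \<and> c < a \<and> a \<noteq> b"
  unfolding pat_def Pi4_def by (simp add: order_isomorphic_patterns del: One_nat_def) linarith

definition no_123_132_below :: "nat list \<Rightarrow> nat \<Rightarrow> bool" where
  "no_123_132_below w u \<longleftrightarrow> (\<forall>c b a. before w c b \<longrightarrow> before w b a \<longrightarrow> c < b \<longrightarrow> c < a \<longrightarrow> u \<le> b)"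

definition rlmax :: "nat list \<Rightarrow> nat \<Rightarrow> bool" where
  "rlmax w y \<longleftrightarrow> (\<forall>z. before w y z \<longrightarrow> z < y)"

definition bottom_level :: "nat \<Rightarrow> (nat \<Rightarrow> bool) \<Rightarrow> nat \<Rightarrow> bool" where
  "bottom_level n P \<beta> \<longleftrightarrow> \<beta> \<in> {1..Suc n} \<and> (\<forall>u\<in>{1..Suc n}. P u \<longleftrightarrow> u \<le> \<beta>)"

lemma bottom_levelD: "bottom_level n P \<beta> \<Longrightarrow> 1 \<le> u \<Longrightarrow> u \<le> Suc n \<Longrightarrow> P u \<longleftrightarrow> u \<le> \<beta>"
  by (simp add: bottom_level_def)

lemma rlmax_prepend:
  assumes "w \<in> perms n" "v \<in> {1..Suc n}"
  shows "rlmax (prepend v w) (bump v y) \<longleftrightarrow> rlmax w y" "rlmax (prepend v w) v \<longleftrightarrow> v = Suc n"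
proof -
  show "rlmax (prepend v w) (bump v y) \<longleftrightarrow> rlmax w y"
    unfolding rlmax_def before_prepend by auto
  have "rlmax (prepend v w) v \<longleftrightarrow> (\<forall>z\<in>{1..n}. z < v)"
    unfolding rlmax_def before_prepend permsD(2)[OF assms(1)] by auto
  also have "\<dots> \<longleftrightarrow> v = Suc n"
  proof (cases "v = Suc n")
    case False
    then have "v \<in> {1..n}"
      using assms(2) by simp
    then show ?thesis
      using False by blast
  qed simp
  finally show "rlmax (prepend v w) v \<longleftrightarrow> v = Suc n" .
qed

lemma rlmax_prepend_less:
  assumes "w \<in> perms n" "v \<in> {1..Suc n}"
  shows "y < v \<Longrightarrow> rlmax (prepend v w) y \<longleftrightarrow> rlmax w y"
    "v \<le> y \<Longrightarrow> rlmax (prepend v w) (Suc y) \<longleftrightarrow> rlmax w y"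
  using rlmax_prepend(1)[OF assms, of y] by (simp_all add: bump_def)

lemma rlmax_max: "w \<in> perms n \<Longrightarrow> rlmax w n"
proof -
  assume w: "w \<in> perms n"
  have "z < n" if "before w n z" for z
    using before_in_set[OF that] before_neq[OF permsD(1)[OF w] that] permsD(2)[OF w] by simp
  then show ?thesis
    by (simp add: rlmax_def)
qed

lemma no_123_132_below_prepend:
  "no_123_132_below (prepend v w) u \<longleftrightarrow> no_123_132_below w (if u \<le> v then u else u - 1) \<and>
    (\<forall>b a. before w b a \<longrightarrow> v \<le> b \<longrightarrow> v \<le> a \<longrightarrow> (if u \<le> v then u else u - 1) \<le> b)"
  unfolding no_123_132_below_def all_before_before_prepend le_bump_iff by simp

text \<open>The new entry acts as the 1 of a 123 or 132, so the new bound comes from the least old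
  value \<ge> \<open>v\<close> that precedes another such value. That is \<open>v\<close> unless
  \<open>v\<close> is a right-to-left maximum, and then \<open>Suc v\<close>; the old bound matters
  only for v = \<beta>.\<close>

lemma Pi4_level:
  assumes w: "w \<in> perms n" and \<beta>: "bottom_level n (no_123_132_below w) \<beta>" and v: "v \<in> {1..\<beta>}"
  shows "bottom_level (Suc n) (no_123_132_below (prepend v w))
    (if v < \<beta> \<and> rlmax w v then Suc (Suc v) else Suc v)"
  unfolding bottom_level_def
proof (intro conjI ballI)
  have \<beta>n: "\<beta> \<le> Suc n"
    using \<beta> by (simp add: bottom_level_def)
  then show "(if v < \<beta> \<and> rlmax w v then Suc (Suc v) else Suc v) \<in> {1..Suc (Suc n)}"
    using v by auto
  have set: "before w b c \<Longrightarrow> b \<in> {1..n} \<and> c \<in> {1..n} \<and> b \<noteq> c" for b c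
    using before_in_set[of w b c] before_neq[of w b c] permsD[OF w] by auto
  fix u assume u: "u \<in> {1..Suc (Suc n)}"
  show "no_123_132_below (prepend v w) u \<longleftrightarrow> u \<le> (if v < \<beta> \<and> rlmax w v then Suc (Suc v) else Suc v)"
  proof (cases "u \<le> Suc v")
    case True
    have "no_123_132_below w (if u \<le> v then u else u - 1)"
      using bottom_levelD[OF \<beta>, of "if u \<le> v then u else u - 1"] True u v \<beta>n by auto
    moreover have "(if u \<le> v then u else u - 1) \<le> v"
      using True by auto
    ultimately show ?thesis
      using True unfolding no_123_132_below_prepend by auto
  next
    case False
    then have vn: "v \<in> set w"
      using u v permsD(2)[OF w] by auto
    have pre: "no_123_132_below (prepend v w) u \<longleftrightarrow> u - 1 \<le> \<beta> \<and>
        (\<forall>b a. before w b a \<longrightarrow> v \<le> b \<longrightarrow> v \<le> a \<longrightarrow> u - 1 \<le> b)"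
      using bottom_levelD[OF \<beta>, of "u - 1"] False u unfolding no_123_132_below_prepend by auto
    show ?thesis
    proof (cases "v < \<beta>")
      case False
      then show ?thesis
        using pre \<open>\<not> u \<le> Suc v\<close> v by auto
    next
      case v\<beta>: True
      show ?thesis
      proof (cases "rlmax w v")
        case notM: False
        then obtain a where "before w v a" "v \<le> a"
          unfolding rlmax_def by (auto simp: not_less)
        moreover have "\<not> u - 1 \<le> v"
          using \<open>\<not> u \<le> Suc v\<close> by simp
        ultimately have "\<not> no_123_132_below (prepend v w) u"
          unfolding pre by blast
        then show ?thesis
          using notM \<open>\<not> u \<le> Suc v\<close> by simp
      next
        case M: True
        have "Suc v \<le> b" if "before w b a" "v \<le> b" "v \<le> a" for a b
          using that M set[OF that(1)] unfolding rlmax_def by (cases "b = v") auto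
        moreover have "u \<le> Suc (Suc v)" if "\<forall>b a. before w b a \<longrightarrow> v \<le> b \<longrightarrow> v \<le> a \<longrightarrow> u - 1 \<le> b"
        proof (rule ccontr)
          assume "\<not> u \<le> Suc (Suc v)"
          then have "Suc v \<in> set w"
            using u permsD(2)[OF w] by auto
          \<comment> \<open>A right-to-left maximum cannot precede a larger value; hence the pair
            \<open>Suc v\<close>, \<open>v\<close> gives the bound.\<close>
          then have "before w (Suc v) v"
            using before_total[of v w "Suc v"] vn M unfolding rlmax_def by auto
          then have "u - 1 \<le> Suc v"
            using that by simp
          then show False
            using \<open>\<not> u \<le> Suc (Suc v)\<close> by simp
        qed
        moreover have "u - 1 \<le> Suc v \<longleftrightarrow> u \<le> Suc (Suc v)"
          by auto
        ultimately have "no_123_132_below (prepend v w) u \<longleftrightarrow> u \<le> Suc (Suc v)"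
          using v\<beta> unfolding pre by (meson Suc_leI order_trans)
        then show ?thesis
          using M v\<beta> by simp
      qed
    qed
  qed
qed

section \<open>The weights for \<open>Pi4\<close>\<close>

definition inv_2_Cat :: "real fps" where
  "inv_2_Cat = inverse (2 - Cat)"

lemma inv_2_Cat: "inv_2_Cat * (2 - Cat) = 1"
  unfolding inv_2_Cat_def by (rule inverse_mult_eq_1) simp

text \<open>If \<open>\<beta> \<le> n\<close> is the largest admissible value, the series at \<open>w\<close> is \<open>C\<close> times the product of
  \<open>1 / (2 - C)\<close> over the right-to-left maxima below \<open>\<beta>\<close> and of \<open>C\<close> over the other values below \<open>\<beta>\<close>.\<close>

definition weight :: "nat list \<Rightarrow> nat \<Rightarrow> real fps" where
  "weight w m = (\<Prod>y\<in>{1..<m}. if rlmax w y then inv_2_Cat else Cat)"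

lemma weight_1 [simp]: "weight w (Suc 0) = 1"
  by (simp add: weight_def)

lemma weight_Suc: "1 \<le> m \<Longrightarrow> weight w (Suc m) = weight w m * (if rlmax w m then inv_2_Cat else Cat)"
  by (simp add: weight_def)

text \<open>This is where the two factors come from. With S the sum and P the weight, C - x C^2 = 1
  turns the equation into 1 + x S = P. Passing to m + 1 multiplies P by f, where f = 1 + x C^2 = C
  at an ordinary value, and f = 1 + x C^2 f, that is (2 - C) f = 1, at a right-to-left
  maximum.\<close>

lemma weight_sum:
  assumes "1 \<le> m"
  shows "1 + fps_X * ((\<Sum>v\<in>{1..<m}. Cat * (weight w v * Cat * (if rlmax w v then inv_2_Cat else 1))) +
    Cat * (weight w m * Cat)) = Cat * weight w m"
  using assms
proof (induction m rule: dec_induct)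
  case base
  then show ?case
    using Cat_eq by (simp add: power2_eq_square)
next
  case (step m)
  define S where "S = (\<Sum>v\<in>{1..<m}. Cat * (weight w v * Cat * (if rlmax w v then inv_2_Cat else 1)))"
  define P where "P = weight w m"
  have IH: "1 + fps_X * (S + Cat * (P * Cat)) = Cat * P"
    using step by (simp add: S_def P_def)
  have "1 + fps_X * ((S + Cat * (P * Cat * inv_2_Cat)) + Cat * (P * inv_2_Cat * Cat)) = Cat * (P * inv_2_Cat)"
    using IH Cat_eq inv_2_Cat by algebra
  moreover have "1 + fps_X * ((S + Cat * (P * Cat * 1)) + Cat * (P * Cat * Cat)) = Cat * (P * Cat)"
    using IH Cat_eq by algebra
  ultimately show ?case
    using step(1) by (simp add: weight_Suc S_def P_def)
qed

lemma weight_prepend: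
  assumes w: "w \<in> perms n" and v: "v \<in> {1..Suc n}"
  shows "weight (prepend v w) v = weight w v"
    "v \<le> n \<Longrightarrow> weight (prepend v w) (Suc v) = weight w v * Cat"
    "v \<le> n \<Longrightarrow> weight (prepend v w) (Suc (Suc v)) = weight w v * Cat * (if rlmax w v then inv_2_Cat else Cat)"
proof -
  show 1: "weight (prepend v w) v = weight w v"
    unfolding weight_def by (intro prod.cong refl) (simp add: rlmax_prepend_less[OF w v])
  show 2: "v \<le> n \<Longrightarrow> weight (prepend v w) (Suc v) = weight w v * Cat"
    using v by (simp add: weight_Suc 1 rlmax_prepend(2)[OF w v])
  show "v \<le> n \<Longrightarrow> weight (prepend v w) (Suc (Suc v)) = weight w v * Cat * (if rlmax w v then inv_2_Cat else Cat)"
    by (subst weight_Suc) (simp_all add: 2 rlmax_prepend_less[OF w v])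
qed

lemma avoiders_gf_Pi4: "avoiders_gf Pi4 = gf"
proof -
  \<comment> \<open>If n > 0 and all values are admissible, inserting n or n + 1 leads to the same
    kind of state. Dividing by the weight leaves
    \<open>D * Cat = 1 + fps_X * (D * Cat * (Cat + inv_2_Cat))\<close>, which determines
    \<open>D\<close>.\<close>
  define D where "D = Cat * (2 - Cat) * inv_quad"
  define F where "F w n \<beta> = (if \<beta> \<le> n then Cat * weight w \<beta> else if n = 0 then gf else D * Cat * weight w n)"
    for w n \<beta>
  let ?S = "\<lambda>w G. \<exists>\<beta>. bottom_level (length w) (no_123_132_below w) \<beta> \<and> G = F w (length w) \<beta>"
  have "avoiders_gf (rev ` Pi4) = gf"
  proof (rule avoiders_gf_eqI[where R = ?S])
    show "\<forall>\<tau>\<in>rev ` Pi4. length \<tau> = 4"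
      by (simp add: Pi4_def)
    show "?S [] gf"
      by (intro exI[of _ 1]) (auto simp: bottom_level_def no_123_132_below_def F_def)
    fix n w G assume w: "w \<in> perms n" and "?S w G"
    then obtain \<beta> where \<beta>: "bottom_level n (no_123_132_below w) \<beta>" and G: "G = F w n \<beta>"
      using permsD(3)[OF w] by auto
    have \<beta>n: "1 \<le> \<beta>" "\<beta> \<le> Suc n"
      using \<beta> by (auto simp: bottom_level_def)
    have s: "sites (rev ` Pi4) w = {1..\<beta>}"
    proof -
      have "sites (rev ` Pi4) w = {v \<in> {1..Suc n}. no_123_132_below w v}"
        unfolding sites_def pat_rev_Pi4 no_123_132_below_def permsD(3)[OF w] not_le[symmetric]
        using before_neq[OF permsD(1)[OF w]] by blast
      then show ?thesis
        using \<beta> by (auto simp: bottom_level_def)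
    qed
    define t where "t v = Cat * (weight w v * Cat * (if rlmax w v then inv_2_Cat else 1))" for v
    define H where "H v = F (prepend v w) (Suc n) (if v < \<beta> \<and> rlmax w v then Suc (Suc v) else Suc v)" for v
    have Ht: "H v = t v" if "1 \<le> v" "v < \<beta>" "v < n" for v
      using that \<beta>n weight_prepend[OF w, of v] by (simp add: H_def F_def t_def)
    have sum: "1 + fps_X * ((\<Sum>v\<in>{1..<m}. t v) + Cat * (weight w m * Cat)) = Cat * weight w m"
      if "1 \<le> m" for m
      unfolding t_def by (rule weight_sum[OF that])
    have "G = 1 + fps_X * (\<Sum>v\<in>{1..\<beta>}. H v)"
    proof (cases "\<beta> \<le> n")
      case True
      have "(\<Sum>v\<in>{1..\<beta>}. H v) = (\<Sum>v\<in>{1..<\<beta>}. H v) + H \<beta>"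
        using \<beta>n by (simp add: sum.last_plus atLeastLessThanSuc_atLeastAtMost[symmetric])
      also have "(\<Sum>v\<in>{1..<\<beta>}. H v) = (\<Sum>v\<in>{1..<\<beta>}. t v)"
        using True by (intro sum.cong refl Ht) auto
      also have "H \<beta> = Cat * (weight w \<beta> * Cat)"
        using True \<beta>n weight_prepend(2)[OF w, of \<beta>] by (simp add: H_def F_def)
      finally show ?thesis
        using sum[OF \<beta>n(1)] True by (simp add: G F_def)
    next
      case False
      then have \<beta>: "\<beta> = Suc n"
        using \<beta>n by simp
      show ?thesis
      proof (cases "n = 0")
        case True
        have "gf = 1 + fps_X * (D * Cat)"
          unfolding gf_def D_def using Cat_eq inv_quad by algebra
        moreover have "H 1 = D * Cat"
          using weight_prepend(1)[OF w, of 1] True by (simp add: H_def F_def \<beta>)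
        ultimately show ?thesis
          using True by (simp add: \<beta> G F_def)
      next
        case n: False
        have "(\<Sum>v\<in>{1..\<beta>}. H v) = (\<Sum>v\<in>{1..<n}. H v) + H n + H (Suc n)"
          using n by (simp add: \<beta> atLeastLessThanSuc_atLeastAtMost[symmetric])
        also have "(\<Sum>v\<in>{1..<n}. H v) = (\<Sum>v\<in>{1..<n}. t v)"
          by (intro sum.cong refl Ht) (auto simp: \<beta>)
        also have "H n = D * Cat * (weight w n * Cat)"
          using weight_prepend(2)[OF w, of n] n rlmax_max[OF w] by (simp add: H_def F_def \<beta>)
        also have "H (Suc n) = D * Cat * (weight w n * inv_2_Cat)"
          using weight_prepend(1)[OF w, of "Suc n"] n rlmax_max[OF w] by (simp add: H_def F_def \<beta> weight_Suc)
        finally have S: "(\<Sum>v\<in>{1..\<beta>}. H v) = (\<Sum>v\<in>{1..<n}. t v) + D * Cat * (weight w n * Cat) +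
          D * Cat * (weight w n * inv_2_Cat)" .
        have "D * Cat * P = 1 + fps_X * (T + D * Cat * (P * Cat) + D * Cat * (P * inv_2_Cat))"
          if "1 + fps_X * (T + Cat * (P * Cat)) = Cat * P" for T P
        proof -
          have D: "D * Cat = 1 + fps_X * (D * Cat * (Cat + inv_2_Cat))"
            unfolding D_def using Cat_eq inv_quad inv_2_Cat by algebra
          have "1 + fps_X * T = P"
            using that Cat_eq by algebra
          have "D * Cat * P = (1 + fps_X * (D * Cat * (Cat + inv_2_Cat))) * P"
            using arg_cong[OF D, of "\<lambda>A. A * P"] .
          also have "\<dots> = P + fps_X * (D * Cat * (P * Cat) + D * Cat * (P * inv_2_Cat))"
            by (simp add: algebra_simps)
          also have "\<dots> = 1 + fps_X * T + fps_X * (D * Cat * (P * Cat) + D * Cat * (P * inv_2_Cat))"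
            using \<open>1 + fps_X * T = P\<close> by simp
          also have "\<dots> = 1 + fps_X * (T + D * Cat * (P * Cat) + D * Cat * (P * inv_2_Cat))"
            by (simp add: algebra_simps)
          finally show ?thesis .
        qed
        from this[OF sum[of n]] show ?thesis
          unfolding S using n by (simp add: G F_def \<beta>)
      qed
    qed
    moreover have "?S (prepend v w) (H v)" if "v \<in> {1..\<beta>}" for v
      using Pi4_level[OF w \<beta> that] unfolding length_prepend permsD(3)[OF w] H_def by blast
    ultimately show "\<exists>H. G = 1 + fps_X * (\<Sum>v\<in>sites (rev ` Pi4) w. H v) \<and>
        (\<forall>v\<in>sites (rev ` Pi4) w. ?S (prepend v w) (H v))"
      unfolding s by blast
  qed
  then show ?thesis
    by (simp add: avoiders_gf_rev)
qed

section \<open>The class of \<open>\<Pi>\<^sub>5\<close>\<close>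

text \<open>4123 and 3124 forbid a 123 with middle entry below \<open>v\<close> and bound
  \<open>v\<close> from above; 1423 forbids a 312 above \<open>v\<close> and bounds it from
  below.\<close>

lemma pat_rev_Pi5:
  "pat (rev ` Pi5) v (bump v x) (bump v y) (bump v z) \<longleftrightarrow>
    x < y \<and> y < z \<and> y < v \<or> v \<le> x \<and> v \<le> y \<and> v \<le> z \<and> y < z \<and> z < x"
  unfolding pat_def Pi5_def by (simp add: order_isomorphic_patterns del: One_nat_def) linarith

definition no_123_below :: "nat list \<Rightarrow> nat \<Rightarrow> bool" where
  "no_123_below w u \<longleftrightarrow> (\<forall>x y z. before w x y \<longrightarrow> before w y z \<longrightarrow> x < y \<longrightarrow> y < z \<longrightarrow> u \<le> y)"

abbreviation no_312_above :: "nat list \<Rightarrow> nat \<Rightarrow> bool" where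
  "no_312_above \<equiv> avoids_above (\<lambda>x y z. y < z \<and> z < x)"

definition descending_between :: "nat list \<Rightarrow> nat \<Rightarrow> nat \<Rightarrow> bool" where
  "descending_between w u v \<longleftrightarrow> (\<forall>y z. before w y z \<longrightarrow> u \<le> y \<longrightarrow> y < z \<longrightarrow> \<not> z < v)"

definition upper_level :: "nat \<Rightarrow> (nat \<Rightarrow> bool) \<Rightarrow> nat \<Rightarrow> bool" where
  "upper_level n P l \<longleftrightarrow> l \<in> {1..Suc n} \<and> (\<forall>u\<in>{1..Suc n}. P u \<longleftrightarrow> l \<le> u)"

lemma upper_levelD: "upper_level n P l \<Longrightarrow> 1 \<le> u \<Longrightarrow> u \<le> Suc n \<Longrightarrow> P u \<longleftrightarrow> l \<le> u"
  by (simp add: upper_level_def)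

lemma no_123_below_prepend:
  "no_123_below (prepend v w) u \<longleftrightarrow> no_123_below w (if u \<le> v then u else u - 1) \<and>
    (\<forall>y z. before w y z \<longrightarrow> v \<le> y \<longrightarrow> y < z \<longrightarrow> (if u \<le> v then u else u - 1) \<le> y)"
  unfolding no_123_below_def all_before_before_prepend le_bump_iff by simp

lemma no_312_above_prepend:
  "no_312_above (prepend v w) u \<longleftrightarrow> no_312_above w (if u \<le> v then u else u - 1) \<and>
    (u \<le> v \<longrightarrow> descending_between w u v)"
proof -
  have "no_312_above (prepend v w) u \<longleftrightarrow> no_312_above w (if u \<le> v then u else u - 1) \<and>
    (u \<le> v \<longrightarrow> (\<forall>b c. before w b c \<longrightarrow> u \<le> b \<longrightarrow> u \<le> c \<longrightarrow> \<not> (bump v b < bump v c \<and> bump v c < v)))"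
    by (rule avoids_above_prepend) simp
  then show ?thesis
    unfolding descending_between_def bump_less_iff bump_less_self_iff by (meson less_imp_le order_trans)
qed

text \<open>An old value y \<ge> \<open>v\<close> becomes the middle of a 123 starting at the new
  entry iff it is not a right-to-left maximum. So \<mu> is the first such value from
  \<open>v\<close> on, capped at the old bound.\<close>

lemma no_123_below_prepend_level:
  assumes w: "w \<in> perms n" and \<beta>: "bottom_level n (no_123_below w) \<beta>" and v: "1 \<le> v" "v \<le> \<mu>" "\<mu> \<le> \<beta>"
    and run: "\<forall>y\<in>{v..<\<mu>}. rlmax w y" and stop: "\<mu> = \<beta> \<or> \<not> rlmax w \<mu>"
  shows "bottom_level (Suc n) (no_123_below (prepend v w)) (Suc \<mu>)"
  unfolding bottom_level_def
proof (intro conjI ballI)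
  have \<beta>n: "\<beta> \<le> Suc n"
    using \<beta> by (simp add: bottom_level_def)
  then show "Suc \<mu> \<in> {1..Suc (Suc n)}"
    using v by simp
  fix u assume u: "u \<in> {1..Suc (Suc n)}"
  let ?u = "if u \<le> v then u else u - 1"
  have u1: "1 \<le> ?u" "?u \<le> Suc n" "?u \<le> \<mu> \<longleftrightarrow> u \<le> Suc \<mu>"
    using u v \<beta>n by auto
  have "no_123_below (prepend v w) u \<longleftrightarrow> ?u \<le> \<beta> \<and> (\<forall>y z. before w y z \<longrightarrow> v \<le> y \<longrightarrow> y < z \<longrightarrow> ?u \<le> y)"
    unfolding no_123_below_prepend using bottom_levelD[OF \<beta> u1(1,2)] by simp
  also have "\<dots> \<longleftrightarrow> ?u \<le> \<mu>"
  proof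
    assume *: "?u \<le> \<beta> \<and> (\<forall>y z. before w y z \<longrightarrow> v \<le> y \<longrightarrow> y < z \<longrightarrow> ?u \<le> y)"
    show "?u \<le> \<mu>"
    proof (cases "\<mu> = \<beta>")
      case False
      then obtain z where z: "before w \<mu> z" "\<not> z < \<mu>"
        using stop by (auto simp: rlmax_def)
      then have "\<mu> < z"
        using before_neq[OF permsD(1)[OF w] z(1)] by simp
      then show ?thesis
        using * z(1) v(2) by blast
    qed (use * in simp)
  next
    assume *: "?u \<le> \<mu>"
    have "?u \<le> y" if "before w y z" "v \<le> y" "y < z" for y z
    proof (rule ccontr)
      assume "\<not> ?u \<le> y"
      then have "y \<in> {v..<\<mu>}"
        using * that(2) by simp
      then have "z < y"
        using run that(1) unfolding rlmax_def by blast
      then show False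
        using that(3) by simp
    qed
    then show "?u \<le> \<beta> \<and> (\<forall>y z. before w y z \<longrightarrow> v \<le> y \<longrightarrow> y < z \<longrightarrow> ?u \<le> y)"
      using * v(3) order_trans by blast
  qed
  finally show "no_123_below (prepend v w) u \<longleftrightarrow> u \<le> Suc \<mu>"
    using u1(3) by simp
qed

text \<open>The new first entry can only be the 3 of a 312, so the values from the threshold up to
  \<open>v\<close> must not rise. Lower thresholds demand more, hence it is enough that m - 1
  fails.\<close>

lemma no_312_above_prepend_level:
  assumes l: "upper_level n (no_312_above w) l" and v: "l \<le> m" "m \<le> v" "v \<le> Suc n"
    and desc: "descending_between w m v" and stop: "m = l \<or> \<not> descending_between w (m - 1) v"
  shows "upper_level (Suc n) (no_312_above (prepend v w)) m"
  unfolding upper_level_def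
proof (intro conjI ballI)
  have l1: "1 \<le> l"
    using l by (simp add: upper_level_def)
  then show "m \<in> {1..Suc (Suc n)}"
    using v by simp
  fix u assume u: "u \<in> {1..Suc (Suc n)}"
  show "no_312_above (prepend v w) u \<longleftrightarrow> m \<le> u"
  proof (cases "u \<le> v")
    case False
    then show ?thesis
      using upper_levelD[OF l, of "u - 1"] u v l1 unfolding no_312_above_prepend by auto
  next
    case True
    have mono: "descending_between w t v" if "descending_between w s v" "s \<le> t" for s t
      using that unfolding descending_between_def by (meson order_trans)
    have "no_312_above (prepend v w) u \<longleftrightarrow> l \<le> u \<and> descending_between w u v"
      using upper_levelD[OF l, of u] u v True unfolding no_312_above_prepend by auto
    also have "\<dots> \<longleftrightarrow> m \<le> u"
    proof
      assume *: "l \<le> u \<and> descending_between w u v"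
      show "m \<le> u"
      proof (rule ccontr)
        assume "\<not> m \<le> u"
        then have "u \<le> m - 1" "m \<noteq> l"
          using * by auto
        then show False
          using stop * mono by blast
      qed
    qed (use desc mono v in auto)
    finally show ?thesis .
  qed
qed

lemma descending_between_adjacent:
  assumes w: "distinct w" and adj: "\<And>y. u \<le> y \<Longrightarrow> Suc y < v \<Longrightarrow> before w (Suc y) y"
  shows "descending_between w u v"
proof -
  have "before w z y" if "Suc y \<le> z" "u \<le> y" "z < v" for y z
    using that
  proof (induction z rule: dec_induct)
    case base
    then show ?case using adj by simp
  next
    case (step z)
    then have "before w (Suc z) z" "before w z y"
      using adj[of z] by auto
    then show ?case
      using before_trans[OF w] by blast
  qed
  then show ?thesis
    unfolding descending_between_def using before_asym[OF w] Suc_leI by blast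
qed

text \<open>The admissible values are \<open>l, \<dots>, l + a + b + c\<close>; those among them that are below the last one are
  \<open>a\<close> right-to-left maxima, followed by \<open>b\<close> other values, followed by \<open>c\<close> right-to-left maxima.\<close>

definition window :: "nat list \<Rightarrow> nat \<Rightarrow> nat \<Rightarrow> nat \<Rightarrow> nat \<Rightarrow> nat \<Rightarrow> bool" where
  "window w n l a b c \<longleftrightarrow>
     upper_level n (no_312_above w) l \<and> bottom_level n (no_123_below w) (l + a + b + c) \<and>
     (\<forall>y\<in>{l..<l + a}. rlmax w y) \<and>
     (\<forall>y\<in>{l + a..<l + a + b}. \<not> rlmax w y) \<and>
     (\<forall>y\<in>{l + a + b..<l + a + b + c}. rlmax w y) \<and>
     (b = 0 \<longrightarrow> c = 0 \<and> l + a = Suc n)"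

context
  fixes w n l a b c
  assumes w: "w \<in> perms n" and win: "window w n l a b c"
begin

lemma window_upper: "upper_level n (no_312_above w) l"
  and window_bottom: "bottom_level n (no_123_below w) (l + a + b + c)"
  and window_rlmax1: "l \<le> y \<Longrightarrow> y < l + a \<Longrightarrow> rlmax w y"
  and window_rlmax2: "l + a \<le> y \<Longrightarrow> y < l + a + b \<Longrightarrow> \<not> rlmax w y"
  and window_rlmax3: "l + a + b \<le> y \<Longrightarrow> y < l + a + b + c \<Longrightarrow> rlmax w y"
  and window_b0: "b = 0 \<Longrightarrow> c = 0 \<and> l + a = Suc n"
  using win by (auto simp: window_def)

lemma window_bounds: "1 \<le> l" "l + a + b + c \<le> Suc n"
  using window_upper window_bottom by (auto simp: upper_level_def bottom_level_def)

text \<open>The maximum n is always a right-to-left maximum, so it cannot lie in the middle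
  block.\<close>

lemma window_full: "l + a + b + c = Suc n \<Longrightarrow> 0 < b \<Longrightarrow> 0 < c"
  using window_rlmax2[of n] rlmax_max[OF w] by (cases c) auto

text \<open>If y came before y + 1, then y would not be a right-to-left maximum, hence neither would
  y + 1, and some z would complete a 123 whose middle is below an admissible value.\<close>

lemma window_adjacent:
  assumes y: "l \<le> y" "Suc y < l + a + b + c" "rlmax w y \<or> \<not> rlmax w (Suc y)"
  shows "before w (Suc y) y"
proof (rule ccontr)
  assume "\<not> before w (Suc y) y"
  moreover have "y \<in> set w" "Suc y \<in> set w"
    using y window_bounds permsD(2)[OF w] by auto
  ultimately have yy: "before w y (Suc y)"
    using before_total[of y w "Suc y"] by auto
  then have "\<not> rlmax w y"
    unfolding rlmax_def by auto
  then obtain z where z: "before w (Suc y) z" "\<not> z < Suc y"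
    using y(3) unfolding rlmax_def by blast
  then have "Suc y < z"
    using before_neq[OF permsD(1)[OF w] z(1)] by simp
  moreover have "no_123_below w (l + a + b + c)"
    using window_bottom window_bounds by (auto simp: bottom_level_def)
  ultimately have "l + a + b + c \<le> Suc y"
    using yy z(1) unfolding no_123_below_def by blast
  then show False
    using y(2) by simp
qed

text \<open>The one step not covered by \<open>window_adjacent\<close>, from a non-maximum to a
  maximum, is between the second and the third block.\<close>

lemma window_descending1: "v \<le> l + a + b \<Longrightarrow> descending_between w l v"
proof (rule descending_between_adjacent[OF permsD(1)[OF w]])
  fix y assume "v \<le> l + a + b" "l \<le> y" "Suc y < v"
  then show "before w (Suc y) y"
    using window_rlmax1[of y] window_rlmax2[of "Suc y"] by (intro window_adjacent) force+
qed

lemma window_descending2: "v \<le> l + a + b + c \<Longrightarrow> descending_between w (l + a + b) v"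
proof (rule descending_between_adjacent[OF permsD(1)[OF w]])
  fix y assume "v \<le> l + a + b + c" "l + a + b \<le> y" "Suc y < v"
  then show "before w (Suc y) y"
    using window_rlmax3[of y] by (intro window_adjacent) auto
qed

text \<open>At that step the values do rise: if y + 1 preceded y, it would also precede the larger
  entry that follows y, although y + 1 is a right-to-left maximum.\<close>

lemma window_not_descending:
  assumes "0 < b" "l + a + b < v" "v \<le> l + a + b + c"
  shows "\<not> descending_between w (l + a + b - 1) v"
proof -
  define y where "y = l + a + b - 1"
  have y: "Suc y = l + a + b"
    using assms(1) by (simp add: y_def)
  have "\<not> rlmax w y"
    using window_rlmax2[of y] y assms(1) by simp
  then obtain z where z: "before w y z" "\<not> z < y"
    unfolding rlmax_def by blast
  have M: "rlmax w (Suc y)"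
    using window_rlmax3[of "Suc y"] y assms by simp
  have "before w y (Suc y)"
  proof (rule ccontr)
    assume *: "\<not> before w y (Suc y)"
    have "y \<in> set w" "Suc y \<in> set w"
      using before_in_set[OF z(1)] y assms window_bounds permsD(2)[OF w] by auto
    then have "before w (Suc y) y"
      using * before_total[of y w "Suc y"] by auto
    then have "before w (Suc y) z"
      using before_trans[OF permsD(1)[OF w]] z(1) by blast
    then have "z < Suc y"
      using M unfolding rlmax_def by blast
    then show False
      using z before_neq[OF permsD(1)[OF w] z(1)] by simp
  qed
  then show ?thesis
    unfolding y_def[symmetric] descending_between_def using y assms(2) by force
qed

lemma rlmax_prepend_cases:
  assumes "v \<in> {1..Suc n}"
  shows "rlmax (prepend v w) y \<longleftrightarrow> (if y < v then rlmax w y else if y = v then v = Suc n else rlmax w (y - 1))"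
  using rlmax_prepend_less[OF w assms, of y] rlmax_prepend_less(2)[OF w assms, of "y - 1"]
    rlmax_prepend(2)[OF w assms] by (cases y) auto

text \<open>Everything about the child is expressed through \<open>w\<close>: \<open>m\<close> is
  the new lower end, \<open>Suc \<mu>\<close> the new upper end. The new entry is a right-to-left
  maximum only if it is n + 1.\<close>

lemma window_prependI:
  assumes v: "l \<le> m" "m \<le> v" "v \<le> \<mu>" "\<mu> \<le> l + a + b + c"
    and run: "\<And>y. v \<le> y \<Longrightarrow> y < \<mu> \<Longrightarrow> rlmax w y" and stop: "\<mu> = l + a + b + c \<or> \<not> rlmax w \<mu>"
    and m: "m = l \<and> v \<le> l + a + b \<or> m = l + a + b \<and> l + a + b < v \<and> 0 < b"
    and sum: "m + a' + b' + c' = Suc \<mu>"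
    and M: "\<And>y. m \<le> y \<Longrightarrow> y < m + a' \<Longrightarrow> if y < v then rlmax w y else if y = v then v = Suc n else rlmax w (y - 1)"
      "\<And>y. m + a' \<le> y \<Longrightarrow> y < m + a' + b' \<Longrightarrow> \<not> (if y < v then rlmax w y else if y = v then v = Suc n else rlmax w (y - 1))"
      "\<And>y. m + a' + b' \<le> y \<Longrightarrow> y < m + a' + b' + c' \<Longrightarrow> if y < v then rlmax w y else if y = v then v = Suc n else rlmax w (y - 1)"
    and b0: "b' = 0 \<Longrightarrow> c' = 0 \<and> m + a' = Suc (Suc n)"
  shows "window (prepend v w) (Suc n) m a' b' c'"
proof -
  have v': "v \<in> {1..Suc n}"
    using v window_bounds by auto
  have "upper_level (Suc n) (no_312_above (prepend v w)) m"
  proof (rule no_312_above_prepend_level[OF window_upper])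
    show "descending_between w m v"
      using m window_descending1 window_descending2 v by auto
    show "m = l \<or> \<not> descending_between w (m - 1) v"
      using m window_not_descending v by auto
  qed (use v v' in auto)
  moreover have "bottom_level (Suc n) (no_123_below (prepend v w)) (m + a' + b' + c')"
    unfolding sum using v v' run stop by (intro no_123_below_prepend_level[OF w window_bottom]) auto
  moreover have "\<forall>y\<in>{m..<m + a'}. rlmax (prepend v w) y"
    "\<forall>y\<in>{m + a'..<m + a' + b'}. \<not> rlmax (prepend v w) y"
    "\<forall>y\<in>{m + a' + b'..<m + a' + b' + c'}. rlmax (prepend v w) y"
    unfolding rlmax_prepend_cases[OF v'] using M by (meson atLeastLessThan_iff)+
  ultimately show ?thesis
    unfolding window_def using b0 by blast
qed

text \<open>The new entry becomes the only non-maximum and splits the first block; the first old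
  non-maximum, or the end of the window, sets the upper end.\<close>

lemma window_child1:
  assumes "0 < b \<or> p < a" "p \<le> a"
  shows "window (prepend (l + p) w) (Suc n) l p 1 (a - p)"
  by (rule window_prependI[of l "l + p" "l + a"])
    (use assms window_bounds window_b0 window_rlmax1 window_rlmax2[of "l + a"] in auto)

lemma window_child2:
  assumes "b = 0"
  shows "window (prepend (l + a) w) (Suc n) l (Suc a) 0 0"
  by (rule window_prependI[of l "l + a" "l + a"])
    (use assms window_bounds window_rlmax1 window_b0 in auto)

lemma window_child3:
  assumes "1 \<le> t" "t < b"
  shows "window (prepend (l + a + t) w) (Suc n) l a (Suc t) 0"
  by (rule window_prependI[of l "l + a + t" "l + a + t"])
    (use assms window_bounds window_rlmax1 window_rlmax2 in auto)

lemma window_child4: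
  assumes "0 < b"
  shows "window (prepend (l + a + b) w) (Suc n) l a (Suc b) c"
  by (rule window_prependI[of l "l + a + b" "l + a + b + c"])
    (use assms window_bounds window_full window_rlmax1 window_rlmax2 window_rlmax3 in auto)

text \<open>Past the middle block, the new entry, the last old non-maximum and its successor form a
  312, so the lower end jumps to the third block.\<close>

lemma window_child5:
  assumes "0 < b" "1 \<le> t" "t \<le> c" "l + a + b + t \<le> n"
  shows "window (prepend (l + a + b + t) w) (Suc n) (l + a + b) t 1 (c - t)"
  by (rule window_prependI[of "l + a + b" "l + a + b + t" "l + a + b + c"])
    (use assms window_bounds window_rlmax3 in auto)

lemma window_child6:
  assumes "0 < b" "l + a + b + c = Suc n"
  shows "window (prepend (l + a + b + c) w) (Suc n) (l + a + b) (Suc c) 0 0"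
  by (rule window_prependI[of "l + a + b" "l + a + b + c" "l + a + b + c"])
    (use assms window_bounds window_full window_rlmax3 in auto)

end

section \<open>The series attached to windows\<close>

definition inv_Cat_1 :: "real fps" where
  "inv_Cat_1 = inverse (Cat + 1)"

lemma inv_Cat_1: "inv_Cat_1 * (Cat + 1) = 1"
  unfolding inv_Cat_1_def by (rule inverse_mult_eq_1) simp

text \<open>In state \<open>(a, b, c)\<close> with \<open>b > 0\<close> the series turns out to be \<open>C\<^sup>b\<^sup>-\<^sup>1 e\<^sub>a + \<rho>\<^sub>c\<close> if some value
  \<open>\<le> n + 1\<close> is too large to be admissible and \<open>C\<^sup>b\<^sup>-\<^sup>1 e\<^sub>a + \<sigma>\<^sub>c\<close> otherwise; for \<open>b = 0\<close> it is \<open>C + \<sigma>\<^sub>a\<close>.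
  The three definitions solve the linear recurrences \<open>gf_rho_Suc\<close>, \<open>gf_e_eq\<close> and \<open>gf_sigma_step\<close>.\<close>

definition gf_e :: "nat \<Rightarrow> real fps" where
  "gf_e a = Cat\<^sup>2 * (1 + Cat * (Cat ^ a)\<^sup>2) * inv_Cat_1"

definition gf_rho :: "nat \<Rightarrow> real fps" where
  "gf_rho c = Cat\<^sup>2 * ((Cat ^ c)\<^sup>2 - 1) * inv_Cat_1"

definition gf_sigma :: "nat \<Rightarrow> real fps" where
  "gf_sigma c = inv_Cat_1 * inv_quad * Cat * (Cat ^ c)\<^sup>2 - Cat\<^sup>2 * inv_Cat_1 - (Cat - 1)\<^sup>2 * inv_quad * Cat ^ c"

lemma gf_rho_0 [simp]: "gf_rho 0 = 0"
  by (simp add: gf_rho_def)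

lemma gf_e_eq: "gf_e a = Cat * (Cat + gf_rho a)"
  unfolding gf_e_def gf_rho_def using inv_Cat_1 by algebra

lemma gf_e_0: "gf_e 0 = Cat\<^sup>2"
  by (simp add: gf_e_eq power2_eq_square)

text \<open>Eliminating \<open>gf_e\<close> gives a first-order recurrence with coefficient 1 - x -
  x C = 1/C^2; hence the powers of C^2.\<close>

lemma gf_rho_Suc: "gf_rho (Suc a) = gf_rho a + fps_X * (gf_e (Suc a) + gf_rho (Suc a))"
proof -
  have "Cat\<^sup>2 * ((Cat * P)\<^sup>2 - 1) * inv_Cat_1 = Cat\<^sup>2 * (P\<^sup>2 - 1) * inv_Cat_1 +
      fps_X * (Cat\<^sup>2 * (1 + Cat * (Cat * P)\<^sup>2) * inv_Cat_1 + Cat\<^sup>2 * ((Cat * P)\<^sup>2 - 1) * inv_Cat_1)" for P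
    using inv_Cat_1 Cat_eq by algebra
  from this[of "Cat ^ a"] show ?thesis
    by (simp only: gf_rho_def gf_e_def power_Suc)
qed

text \<open>The characteristic polynomial is again x t^2 - t + 1. The constant and the C^(2c) term
  answer the two parts of \<open>gf_e\<close>; the coefficient of the homogeneous solution C^c is
  fixed by \<open>gf_sigma_1\<close>.\<close>

lemma gf_sigma_step: "fps_X * gf_sigma (Suc (Suc c)) = gf_sigma (Suc c) - gf_sigma c - fps_X * gf_e c"
proof -
  have "fps_X * (inv_Cat_1 * inv_quad * Cat * (Cat * (Cat * P))\<^sup>2 - Cat\<^sup>2 * inv_Cat_1 - (Cat - 1)\<^sup>2 * inv_quad * (Cat * (Cat * P))) =
      (inv_Cat_1 * inv_quad * Cat * (Cat * P)\<^sup>2 - Cat\<^sup>2 * inv_Cat_1 - (Cat - 1)\<^sup>2 * inv_quad * (Cat * P)) -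
      (inv_Cat_1 * inv_quad * Cat * P\<^sup>2 - Cat\<^sup>2 * inv_Cat_1 - (Cat - 1)\<^sup>2 * inv_quad * P) -
      fps_X * (Cat\<^sup>2 * (1 + Cat * P\<^sup>2) * inv_Cat_1)" for P
    using inv_Cat_1 inv_quad Cat_eq by algebra
  from this[of "Cat ^ c"] show ?thesis
    by (simp only: gf_sigma_def gf_e_def power_Suc)
qed

lemma inv_Cat_1_inv_quad: "inv_Cat_1 * inv_quad * Cat = inv_Cat_1 + (Cat - 1) * inv_quad"
  using inv_Cat_1 inv_quad by algebra

lemma gf_sigma_0: "Cat + gf_sigma 0 = gf"
proof -
  have "Cat\<^sup>2 * inv_Cat_1 = Cat - 1 + inv_Cat_1"
    using inv_Cat_1 by algebra
  then show ?thesis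
    unfolding gf_sigma_def gf_def inv_Cat_1_inv_quad power_0 power_one mult_1_right by algebra
qed

lemma gf_sigma_1: "Cat + gf_sigma 0 = 1 + fps_X * (Cat + gf_sigma 1)"
proof -
  have "Cat + gf_sigma 1 = Cat\<^sup>2 * (2 - Cat) * inv_quad"
    unfolding gf_sigma_def inv_Cat_1_inv_quad power_one_right using inv_quad by algebra
  moreover have "gf = 1 + fps_X * (Cat\<^sup>2 * (2 - Cat) * inv_quad)"
    unfolding gf_def using Cat_eq by algebra
  ultimately show ?thesis
    by (simp add: gf_sigma_0)
qed

lemma sum_reverse: "(\<Sum>t=m..a. f (m + a - t)) = (\<Sum>t=m..a. (f t :: real fps))" for m a :: nat
  by (rule sum.reindex_bij_witness[of _ "\<lambda>t. m + a - t" "\<lambda>t. m + a - t"]) auto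

text \<open>The insertions into the first block when b > 0. Reversing the second sum frees the
  summand of \<open>a\<close>, and then \<open>gf_rho_Suc\<close> telescopes.\<close>

lemma sum_gf_e_rho: "fps_X * (\<Sum>p=0..a. gf_e p + gf_rho (a - p)) = fps_X * Cat\<^sup>2 + gf_rho a"
proof -
  have "(\<Sum>p=0..a. gf_e p + gf_rho (a - p)) = (\<Sum>p=0..a. gf_e p + gf_rho p)"
    using sum_reverse[of gf_rho 0 a] by (simp add: sum.distrib)
  moreover have "fps_X * (\<Sum>p=0..a. gf_e p + gf_rho p) = fps_X * Cat\<^sup>2 + gf_rho a"
  proof (induction a)
    case (Suc a)
    then show ?case
      using gf_rho_Suc[of a] by (simp add: distrib_left)
  qed (simp add: gf_e_0)
  ultimately show ?thesis
    by simp
qed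

lemma sum_gf_e_rho': "fps_X * (\<Sum>t=1..c. gf_e t + gf_rho (c - t)) = gf_rho c - fps_X * gf_rho c"
proof -
  have "(\<Sum>p=0..c. gf_e p + gf_rho (c - p)) = Cat\<^sup>2 + gf_rho c + (\<Sum>t=1..c. gf_e t + gf_rho (c - t))"
    by (simp add: sum.atLeast_Suc_atMost gf_e_0)
  then show ?thesis
    using sum_gf_e_rho[of c] by (simp add: algebra_simps)
qed

lemma sum_gf_e_sigma:
  "fps_X * ((\<Sum>t=1..c. gf_e t + gf_sigma (Suc c - t)) + (Cat + gf_sigma (Suc (Suc c)))) =
    gf_sigma (Suc c) - fps_X * gf_sigma (Suc c)"
proof -
  have "(\<Sum>t=1..c. gf_e t + gf_sigma (Suc c - t)) = (\<Sum>t=1..c. gf_e t + gf_sigma t)"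
    using sum_reverse[of gf_sigma 1 c] by (simp add: sum.distrib)
  moreover have "fps_X * ((\<Sum>t=1..c. gf_e t + gf_sigma t) + (Cat + gf_sigma (Suc (Suc c)))) =
    gf_sigma (Suc c) - fps_X * gf_sigma (Suc c)"
  proof (induction c)
    case 0
    have "fps_X * (Cat + s2) = s1 - fps_X * s1"
      if "fps_X * s2 = s1 - s0 - fps_X * Cat\<^sup>2" "Cat + s0 = 1 + fps_X * (Cat + s1)" for s0 s1 s2
      using that Cat_eq by algebra
    from this[OF gf_sigma_step[of 0, unfolded gf_e_0] gf_sigma_1[unfolded One_nat_def]] show ?case
      by simp
  next
    case (Suc c)
    have "fps_X * ((T + (e + s1)) + (Cat + s3)) = s2 - fps_X * s2"
      if "fps_X * (T + (Cat + s2)) = s1 - fps_X * s1" "fps_X * s3 = s2 - s1 - fps_X * e" for T e s1 s2 s3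
      using that by algebra
    from this[OF Suc gf_sigma_step[of "Suc c"]] show ?case
      by simp
  qed
  ultimately show ?thesis
    by simp
qed

lemma sum_Cat_powers': "fps_X * Cat * (\<Sum>t=1..b. Cat ^ t) = Cat ^ b - 1"
proof (induction b)
  case (Suc b)
  have "Cat * P = P + fps_X * Cat * (Cat * P)" for P
    using Cat_eq by algebra
  from this[of "Cat ^ b"] show ?case
    using Suc by (simp add: distrib_left)
qed simp

lemma sum_window_split:
  fixes H :: "nat \<Rightarrow> real fps"
  shows "(\<Sum>v=l..l + a + b + c. H v) =
    (\<Sum>p=0..a. H (l + p)) + (\<Sum>t=1..b. H (l + a + t)) + (\<Sum>t=1..c. H (l + a + b + t))"
proof (induction c)
  case 0
  show ?case
  proof (induction b)
    case 0
    show ?case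
      by (induction a) simp_all
  qed (simp add: add.assoc)
qed (simp add: add.assoc)

lemma avoiders_gf_Pi5: "avoiders_gf Pi5 = gf"
proof -
  \<comment> \<open>Only if n + 1 is admissible can a new maximum be inserted, which creates a state
    with b = 0; hence the two versions of the last term.\<close>
  define F where "F n l a b c = (if b = 0 then Cat + gf_sigma a
    else Cat ^ (b - 1) * gf_e a + (if l + a + b + c = Suc n then gf_sigma c else gf_rho c))" for n l a b c :: nat
  let ?S = "\<lambda>w G. \<exists>l a b c. window w (length w) l a b c \<and> G = F (length w) l a b c"
  have "avoiders_gf (rev ` Pi5) = gf"
  proof (rule avoiders_gf_eqI[where R = ?S])
    show "\<forall>\<tau>\<in>rev ` Pi5. length \<tau> = 4"
      by (simp add: Pi5_def)
    have "window [] 0 1 0 0 0"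
      by (auto simp: window_def upper_level_def bottom_level_def avoids_above_def no_123_below_def)
    moreover have "gf = F 0 1 0 0 0"
      by (simp add: F_def gf_sigma_0)
    ultimately show "?S [] gf"
      by auto
    fix n w G assume w: "w \<in> perms n" and "?S w G"
    then obtain l a b c where win: "window w n l a b c" and G: "G = F n l a b c"
      using permsD(3)[OF w] by auto
    note bounds = window_bounds[OF w win]
    have s: "sites (rev ` Pi5) w = {l..l + a + b + c}"
    proof -
      have "sites (rev ` Pi5) w = {v \<in> {1..Suc n}. no_123_below w v \<and> no_312_above w v}"
        unfolding sites_def pat_rev_Pi5 no_123_below_def avoids_above_def permsD(3)[OF w] not_le[symmetric]
        by blast
      then show ?thesis
        using bounds window_upper[OF w win] window_bottom[OF w win]
        by (auto simp: bottom_level_def upper_level_def)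
    qed
    have "\<exists>h. G = 1 + fps_X * (\<Sum>v=l..l + a + b + c. h v) \<and>
        (\<forall>v\<in>{l..l + a + b + c}. \<exists>l' a' b' c'. window (prepend v w) (Suc n) l' a' b' c' \<and> h v = F (Suc n) l' a' b' c')"
    proof (cases "b = 0")
      case b: True
      then have full: "c = 0" "l + a = Suc n"
        using window_b0[OF w win] by auto
      define h where "h v = (if v < l + a then gf_e (v - l) + gf_sigma (l + a - v) else Cat + gf_sigma (Suc a))" for v
      have "G = 1 + fps_X * (\<Sum>v=l..l + a + b + c. h v)"
      proof (cases a)
        case 0
        then show ?thesis
          using gf_sigma_1 by (simp add: G F_def b full h_def)
      next
        case (Suc a')
        have "(\<Sum>v=l..l + a + b + c. h v) = (\<Sum>p=0..a. h (l + p))"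
          using sum_window_split[of h l a b c] by (simp add: b full)
        also have "\<dots> = h l + (\<Sum>t=1..a'. h (l + t)) + h (l + a)"
          unfolding Suc by (subst sum.atLeast_Suc_atMost) (simp_all add: add.assoc)
        also have "(\<Sum>t=1..a'. h (l + t)) = (\<Sum>t=1..a'. gf_e t + gf_sigma (Suc a' - t))"
          by (intro sum.cong refl) (auto simp: h_def Suc)
        also have "h l = Cat\<^sup>2 + gf_sigma a"
          by (simp add: h_def Suc gf_e_0)
        also have "h (l + a) = Cat + gf_sigma (Suc a)"
          by (simp add: h_def)
        finally have S: "(\<Sum>v=l..l + a + b + c. h v) = Cat\<^sup>2 + gf_sigma a +
          (\<Sum>t=1..a'. gf_e t + gf_sigma (Suc a' - t)) + (Cat + gf_sigma (Suc a))" .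
        have "Cat + s1 = 1 + fps_X * (Cat\<^sup>2 + s1 + T + (Cat + s2))"
          if "fps_X * (T + (Cat + s2)) = s1 - fps_X * s1" for s1 s2 T
          using that Cat_eq by algebra
        from this[OF sum_gf_e_sigma[of a']] show ?thesis
          unfolding S G using b Suc by (simp add: F_def)
      qed
      moreover have "\<exists>l' a' b' c'. window (prepend v w) (Suc n) l' a' b' c' \<and> h v = F (Suc n) l' a' b' c'"
        if "v \<in> {l..l + a + b + c}" for v
      proof (cases "v < l + a")
        case True
        define p where "p = v - l"
        have v: "v = l + p" "p < a"
          using that True by (auto simp: p_def)
        \<comment> \<open>The child's window again reaches its top value n + 2, which selects
          \<open>gf_sigma\<close>.\<close>
        have "Suc n - (l + p) = a - p"
          using full v by simp
        then have "window (prepend v w) (Suc n) l p 1 (a - p)" "h v = F (Suc n) l p 1 (a - p)"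
          using window_child1[OF w win, of p] full v by (auto simp: h_def F_def)
        then show ?thesis by blast
      next
        case False
        then have "v = l + a"
          using that b full by simp
        then have "window (prepend v w) (Suc n) l (Suc a) 0 0" "h v = F (Suc n) l (Suc a) 0 0"
          using window_child2[OF w win b] by (simp_all add: h_def F_def)
        then show ?thesis by blast
      qed
      ultimately show ?thesis by blast
    next
      case b: False
      define s where "s c' = (if l + a + b + c = Suc n then gf_sigma c' else gf_rho c')" for c'
      define h where "h v = (if v \<le> l + a then gf_e (v - l) + gf_rho (l + a - v)
        else if v < l + a + b then Cat ^ (v - (l + a)) * gf_e a
        else if v = l + a + b then Cat ^ b * gf_e a + s c
        else if v = Suc n then Cat + gf_sigma (Suc c)
        else gf_e (v - (l + a + b)) + s (l + a + b + c - v))" for v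
      have part1: "(\<Sum>p=0..a. h (l + p)) = (\<Sum>p=0..a. gf_e p + gf_rho (a - p))"
        by (intro sum.cong refl) (auto simp: h_def)
      have part2: "(\<Sum>t=1..b. h (l + a + t)) = (\<Sum>t=1..b. Cat ^ t) * gf_e a + s c"
      proof -
        obtain b' where b': "b = Suc b'"
          using b by (cases b) auto
        have "(\<Sum>t=1..b'. h (l + a + t)) = (\<Sum>t=1..b'. Cat ^ t * gf_e a)"
          by (intro sum.cong refl) (auto simp: h_def b')
        then show ?thesis
          by (simp add: b' h_def sum_distrib_right distrib_right)
      qed
      \<comment> \<open>Both versions of \<open>s\<close> satisfy the same equation, so they are
        treated together afterwards. If n + 1 is admissible, the term t = c is the insertion of the
        new maximum.\<close>
      have part3: "fps_X * (\<Sum>t=1..c. h (l + a + b + t)) = s c - fps_X * s c"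
      proof (cases "l + a + b + c = Suc n")
        case True
        then obtain c' where c': "c = Suc c'"
          using window_full[OF w win] b by (cases c) auto
        have "(\<Sum>t=1..c'. h (l + a + b + t)) = (\<Sum>t=1..c'. gf_e t + gf_sigma (Suc c' - t))"
          using True b by (intro sum.cong refl) (auto simp: h_def s_def c')
        moreover have "h (l + a + b + c) = Cat + gf_sigma (Suc c)"
          using True b by (auto simp: h_def c')
        ultimately show ?thesis
          using sum_gf_e_sigma[of c'] True by (simp add: c' s_def)
      next
        case False
        then have "(\<Sum>t=1..c. h (l + a + b + t)) = (\<Sum>t=1..c. gf_e t + gf_rho (c - t))"
          using bounds by (intro sum.cong refl) (auto simp: h_def s_def)
        then show ?thesis
          using sum_gf_e_rho'[of c] False by (simp add: s_def)
      qed
      have "G = 1 + fps_X * (\<Sum>v=l..l + a + b + c. h v)"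
      proof -
        obtain b' where b': "b = Suc b'"
          using b by (cases b) auto
        have "P * (Cat * (Cat + r)) + s c = 1 + fps_X * (A + (B * (Cat * (Cat + r)) + s c) + T)"
          if "fps_X * A = fps_X * Cat\<^sup>2 + r" "fps_X * Cat * B = Cat * P - 1" "fps_X * T = s c - fps_X * s c"
          for A B T r P
        proof -
          have "1 + fps_X * (A + (B * (Cat * (Cat + r)) + s c) + T) =
            1 + fps_X * A + fps_X * Cat * B * (Cat + r) + fps_X * s c + fps_X * T"
            by (simp add: algebra_simps)
          also have "\<dots> = (1 + fps_X * Cat\<^sup>2) + r + (Cat * P - 1) * (Cat + r) + s c"
            unfolding that by simp
          also have "\<dots> = P * (Cat * (Cat + r)) + s c"
            unfolding Cat_eq[symmetric] by (simp add: algebra_simps)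
          finally show ?thesis ..
        qed
        from this[OF sum_gf_e_rho[of a] sum_Cat_powers'[of b, unfolded b' power_Suc] part3]
        show ?thesis
          unfolding sum_window_split part1 part2 by (simp add: G F_def b b' s_def gf_e_eq)
      qed
      moreover have "\<exists>l' a' b' c'. window (prepend v w) (Suc n) l' a' b' c' \<and> h v = F (Suc n) l' a' b' c'"
        if v: "v \<in> {l..l + a + b + c}" for v
      proof -
        consider p where "v = l + p" "p \<le> a" | t where "v = l + a + t" "1 \<le> t" "t < b" | "v = l + a + b"
          | t where "v = l + a + b + t" "1 \<le> t" "t \<le> c" "v \<le> n" | "v = l + a + b + c" "v = Suc n" "1 \<le> c"
        proof -
          have "v = l + (v - l) \<and> v - l \<le> a \<or> v = l + a + (v - (l + a)) \<and> 1 \<le> v - (l + a) \<and> v - (l + a) < b \<or>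
            v = l + a + b \<or> v = l + a + b + (v - (l + a + b)) \<and> 1 \<le> v - (l + a + b) \<and> v - (l + a + b) \<le> c \<and> v \<le> n \<or>
            v = l + a + b + c \<and> v = Suc n \<and> 1 \<le> c"
            using v bounds by auto
          then show thesis
            using that by blast
        qed
        then show ?thesis
        proof cases
          case (1 p)
          then have "window (prepend v w) (Suc n) l p 1 (a - p)" "h v = F (Suc n) l p 1 (a - p)"
            using window_child1[OF w win, of p] b bounds by (auto simp: h_def F_def)
          then show ?thesis by blast
        next
          case (2 t)
          then have "window (prepend v w) (Suc n) l a (Suc t) 0" "h v = F (Suc n) l a (Suc t) 0"
            using window_child3[OF w win, of t] bounds by (auto simp: h_def F_def)
          then show ?thesis by blast
        next
          case 3
          then have "window (prepend v w) (Suc n) l a (Suc b) c" "h v = F (Suc n) l a (Suc b) c"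
            using window_child4[OF w win] b by (auto simp: h_def F_def s_def)
          then show ?thesis by blast
        next
          case (4 t)
          then have "window (prepend v w) (Suc n) (l + a + b) t 1 (c - t)" "h v = F (Suc n) (l + a + b) t 1 (c - t)"
            using window_child5[OF w win, of t] b by (auto simp: h_def F_def s_def)
          then show ?thesis by blast
        next
          case 5
          then have "window (prepend v w) (Suc n) (l + a + b) (Suc c) 0 0" "h v = F (Suc n) (l + a + b) (Suc c) 0 0"
            using window_child6[OF w win] b by (auto simp: h_def F_def)
          then show ?thesis by blast
        qed
      qed
      ultimately show ?thesis by blast
    qed
    then show "\<exists>H. G = 1 + fps_X * (\<Sum>v\<in>sites (rev ` Pi5) w. H v) \<and>
        (\<forall>v\<in>sites (rev ` Pi5) w. ?S (prepend v w) (H v))"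
      unfolding s length_prepend permsD(3)[OF w] .
  qed
  then show ?thesis
    by (simp add: avoiders_gf_rev)
qed

theorem theorem1:
  shows "\<forall>T \<in> {Pi1, Pi2, Pi3, Pi4, Pi5}.
    avoiders_gf T =
      (1 - 5 * fps_X + (1 + fps_X) * sqrt_1_minus_4X) /
      (1 - 5 * fps_X + (1 - fps_X) * sqrt_1_minus_4X)"
  unfolding gf_eq
  by (simp add: avoiders_gf_Pi1 avoiders_gf_Pi2 avoiders_gf_Pi3 avoiders_gf_Pi4 avoiders_gf_Pi5)

end
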